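(* Let $f\colon(\Lambda,\mathscr{L})\to(\Gamma,\mathscr{G})$ be a morphism of graphs of groups, $p\in\Lambda$ and $q=f(p)\in\Gamma$. Write $\tilde\Lambda$ and $\tilde\Gamma$ for the Bass–Serre trees of $(\Lambda,\mathscr{L})$ and $(\Gamma,\mathscr{G})$, respectively. There is a unique morphism $\tilde f\colon\tilde\Lambda\to\tilde\Gamma$ such that the square of pointed morphisms with top arrow $\tilde f\colon(\tilde\Lambda,\tilde p)\to(\tilde\Gamma,\tilde q)$, bottom arrow $f\colon(\Lambda,\mathscr{L},p)\to(\Gamma,\mathscr{G},q)$ and vertical arrows $\pi_\Lambda\colon(\tilde\Lambda,\tilde p)\to(\Lambda,\mathscr{L},p)$ and $\pi_\Gamma\colon(\tilde\Gamma,\tilde q)\to(\Gamma,\mathscr{G},q)$ commutes, i.e. $\pi_\Gamma\tilde f=f\pi_\Lambda$. Here $\pi_\Lambda$ and $\pi_\Gamma$ are the covering projections, and $\tilde p$ and $\tilde q$ are the distinguished lifts of $p$ and $q$, respectively.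
   Context: A graph of groups $(\Gamma,\mathscr{G})$ is a connected graph with vertex groups $\mathscr{G}_v$, edge groups $\mathscr{G}_e=\mathscr{G}_{\bar e}$ and monomorphisms $\iota_e\colon\mathscr{G}_e\to\mathscr{G}_{\tau(e)}$ ($\tau(e)$ the terminal vertex of the oriented edge $e$, $\bar e$ its reverse). An ordinary graph is a graph of groups with all groups trivial. A path in $(\Gamma,\mathscr{G})$ is an edge path in $\Gamma$ (whose first and last terms may be segments of edges or empty) with elements of the corresponding vertex groups inserted at the vertices it meets. Homotopy rel endpoints is generated by inserting or deleting $\sigma\bar\sigma$ and replacing $g\,e\,\iota_e(h)\,g'$ by $g\,\iota_{\bar e}(h)\,e\,g'$, $h\in\mathscr{G}_e$. $\pi_1(\Gamma,\mathscr{G},p)$ is the group of homotopy classes of loops at $p$. A morphism of graphs sends vertices to vertices and each edge to an edge or (collapsing it) to a vertex. A morphism $f\colon(\Lambda,\mathscr{L})\to(\Gamma,\mathscr{G})$ of graphs of groups is a morphism of graphs $\Lambda\to\Gamma$, homomorphisms $f_v\colon\mathscr{L}_v\to\mathscr{G}_{f(v)}$, $f_e\colon\mathscr{L}_e\to\mathscr{G}_{f(e)}$ and, for each oriented edge $e$, an element $\delta_e\in\mathscr{G}_{f(\tau(e))}$ such that $f_{\tau(e)}(\iota_e(h))=\delta_e\,\iota_{f(e)}(f_e(h))\,\delta_e^{-1}$ for $h\in\mathscr{L}_e$ (with $\iota_{f(e)}$ the identity if $e$ is collapsed). It acts on paths by $g\mapsto f_v(g)$ for $g\in\mathscr{L}_v$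 and $e\mapsto\delta_{\bar e}f(e)\delta_e^{-1}$, preserving homotopy. The Bass–Serre tree $\tilde\Gamma$ of $(\Gamma,\mathscr{G})$ is the tree, unique up to equivariant isomorphism, on which $\pi_1(\Gamma,\mathscr{G},q)$ acts without inversions with quotient $\Gamma$, inducing the graph of groups structure $\mathscr{G}$. Concretely, taking $q$ to be a vertex (if it is interior to an edge, declare it a vertex with vertex group the edge group), the vertices over $v$ are the homotopy classes of paths from $q$ to $v$ modulo right multiplication by $\mathscr{G}_v$; the edges over $e$ are the homotopy classes of paths $\gamma$ from $q$ to $\tau(\bar e)$ modulo right multiplication by $\iota_{\bar e}(\mathscr{G}_e)$, going from the class of $\gamma$ to the class of $\gamma e$; the distinguished lift $\tilde q$ is the class of the constant path. The covering projection $\pi_\Gamma\colon\tilde\Gamma\to(\Gamma,\mathscr{G})$ is the following morphism of graphs of groups. As a graph morphism it is the quotient map. For each oriented edge $e$ fix a set $S_e$ of left coset representatives of $\iota_e(\mathscr{G}_e)$ in $\mathscr{G}_{\tau(e)}$ containing $1$. The tight path in $\tilde\Gamma$ from $\tilde q$ to a vertex is the lift of a unique path $s_1e_1s_2e_2\cdots s_ke_k1$ with $s_i\in S_{\bar e_i}$ and $e_{i-1}\ne\bar e_i$ whenever $s_i=1$. For an oriented edge $\tilde e$ of $\tilde\Gamma$, if the tight path from $\tilde q$ to $\tau(\tilde e)$ ends with $\tilde e$, set $\delta_{\overline{\tilde e}}=s_k$ for the corresponding path; otherwise set $\delta_{\overline{\tilde e}}=1$. The same definitions apply to $\tilde\Lambda$,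 $\tilde p$ and $\pi_\Lambda$.
   Formalization: Literal equality π_Γ f̃ = f π_Λ can fail when the elements δ_e of f are nontrivial; the square is taken to commute with equal graph morphisms and with group data equal up to a change of reference elements in the vertex and edge groups that is trivial at the base vertex. *)

theory Defs
  imports
    "Graph_Theory.Bidirected_Digraph"
    "Graph_Theory.Digraph_Component"
    "Graph_Theory.Arc_Walk"
    "HOL-Algebra.Elementary_Groups"
begin

section \<open>Graphs of groups\<close>

text \<open>Every edge is represented by two arcs, exchanged by \<open>opp\<close>; \<open>head\<close> is the terminal
  vertex. Vertex and edge groups have carriers in one type \<open>'g\<close>, which is no restriction and is
  needed because an edge group may become a vertex group (by subdivision) and because an edge
  group may be mapped to a vertex group (by collapsing).\<close>

record ('v, 'e, 'g) gog =
  graph :: "('v, 'e) pre_digraph"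
  opp :: "'e \<Rightarrow> 'e"
  vgrp :: "'v \<Rightarrow> 'g monoid"
  egrp :: "'e \<Rightarrow> 'g monoid"
  inc :: "'e \<Rightarrow> 'g \<Rightarrow> 'g"

abbreviation gverts :: "('v, 'e, 'g) gog \<Rightarrow> 'v set" where
  "gverts G \<equiv> verts (graph G)"
abbreviation garcs :: "('v, 'e, 'g) gog \<Rightarrow> 'e set" where
  "garcs G \<equiv> arcs (graph G)"
abbreviation gtail :: "('v, 'e, 'g) gog \<Rightarrow> 'e \<Rightarrow> 'v" where
  "gtail G \<equiv> tail (graph G)"
abbreviation ghead :: "('v, 'e, 'g) gog \<Rightarrow> 'e \<Rightarrow> 'v" where
  "ghead G \<equiv> head (graph G)"

definition graph_of_groups :: "('v, 'e, 'g) gog \<Rightarrow> bool" where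
  "graph_of_groups G \<longleftrightarrow>
     bidirected_digraph (graph G) (opp G) \<and> connected (graph G) \<and>
     (\<forall>v\<in>gverts G. group (vgrp G v)) \<and>
     (\<forall>e\<in>garcs G. group (egrp G e) \<and> egrp G (opp G e) = egrp G e \<and>
        inc G e \<in> mon (egrp G e) (vgrp G (ghead G e)))"


section \<open>Morphisms\<close>

text \<open>An arc is mapped either to an arc (\<open>Inr\<close>) or to a vertex (\<open>Inl\<close>). The next functions
  extend the structure on arcs to such images, a vertex \<open>w\<close> being treated like a degenerate arc
  at \<open>w\<close> with group \<open>vgrp G w\<close> and identity inclusion.\<close>

fun cell_in :: "('v, 'e, 'g) gog \<Rightarrow> 'v + 'e \<Rightarrow> bool" where
  "cell_in G (Inl w) \<longleftrightarrow> w \<in> gverts G"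
| "cell_in G (Inr e) \<longleftrightarrow> e \<in> garcs G"

fun cell_opp :: "('v, 'e, 'g) gog \<Rightarrow> 'v + 'e \<Rightarrow> 'v + 'e" where
  "cell_opp G (Inl w) = Inl w"
| "cell_opp G (Inr e) = Inr (opp G e)"

fun cell_head :: "('v, 'e, 'g) gog \<Rightarrow> 'v + 'e \<Rightarrow> 'v" where
  "cell_head G (Inl w) = w"
| "cell_head G (Inr e) = ghead G e"

fun cell_grp :: "('v, 'e, 'g) gog \<Rightarrow> 'v + 'e \<Rightarrow> 'g monoid" where
  "cell_grp G (Inl w) = vgrp G w"
| "cell_grp G (Inr e) = egrp G e"

fun cell_inc :: "('v, 'e, 'g) gog \<Rightarrow> 'v + 'e \<Rightarrow> 'g \<Rightarrow> 'g" where
  "cell_inc G (Inl w) = (\<lambda>h. h)"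
| "cell_inc G (Inr e) = inc G e"

record ('v, 'e, 'g, 'w, 'd, 'k) gog_mor =
  on_v :: "'v \<Rightarrow> 'w"
  on_e :: "'e \<Rightarrow> 'w + 'd"
  hom_v :: "'v \<Rightarrow> 'g \<Rightarrow> 'k"
  hom_e :: "'e \<Rightarrow> 'g \<Rightarrow> 'k"
  delta :: "'e \<Rightarrow> 'k"

definition gog_morphism ::
  "('v, 'e, 'g) gog \<Rightarrow> ('w, 'd, 'k) gog \<Rightarrow> ('v, 'e, 'g, 'w, 'd, 'k) gog_mor \<Rightarrow> bool" where
  "gog_morphism L G f \<longleftrightarrow>
     (\<forall>v\<in>gverts L. on_v f v \<in> gverts G \<and> hom_v f v \<in> hom (vgrp L v) (vgrp G (on_v f v))) \<and>
     (\<forall>e\<in>garcs L.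
        cell_in G (on_e f e) \<and>
        cell_head G (on_e f e) = on_v f (ghead L e) \<and>
        on_e f (opp L e) = cell_opp G (on_e f e) \<and>
        hom_e f e \<in> hom (egrp L e) (cell_grp G (on_e f e)) \<and>
        (\<forall>h\<in>carrier (egrp L e). hom_e f (opp L e) h = hom_e f e h) \<and>
        (let M = vgrp G (on_v f (ghead L e)) in
           delta f e \<in> carrier M \<and>
           (\<forall>h\<in>carrier (egrp L e).
              hom_v f (ghead L e) (inc L e h) =
              delta f e \<otimes>\<^bsub>M\<^esub> cell_inc G (on_e f e) (hom_e f e h) \<otimes>\<^bsub>M\<^esub> inv\<^bsub>M\<^esub> (delta f e))))"

text \<open>The composite \<open>f \<circ> g\<close> of \<open>g\<close> from \<open>X\<close> and \<open>f\<close> to \<open>G\<close>. The group elements are those for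
  which the action on paths, sending an arc \<open>e\<close> to
  \<open>delta (opp e) \<cdot> f e \<cdot> (delta e)\<inverse>\<close>, is functorial.\<close>

definition mor_comp ::
  "('x, 'y, 'z) gog \<Rightarrow> ('w, 'd, 'k) gog \<Rightarrow> ('v, 'e, 'g, 'w, 'd, 'k) gog_mor \<Rightarrow>
   ('x, 'y, 'z, 'v, 'e, 'g) gog_mor \<Rightarrow> ('x, 'y, 'z, 'w, 'd, 'k) gog_mor" where
  "mor_comp X G f g =
     \<lparr>on_v = (\<lambda>x. on_v f (on_v g x)),
      on_e = (\<lambda>y. case on_e g y of Inl v \<Rightarrow> Inl (on_v f v) | Inr e \<Rightarrow> on_e f e),
      hom_v = (\<lambda>x a. hom_v f (on_v g x) (hom_v g x a)),
      hom_e = (\<lambda>y a. case on_e g y of Inl v \<Rightarrow> hom_v f v (hom_e g y a)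
                                    | Inr e \<Rightarrow> hom_e f e (hom_e g y a)),
      delta = (\<lambda>y. let v = on_v g (ghead X y); M = vgrp G (on_v f v) in
                 hom_v f v (delta g y) \<otimes>\<^bsub>M\<^esub>
                 (case on_e g y of Inl _ \<Rightarrow> \<one>\<^bsub>M\<^esub> | Inr e \<Rightarrow> delta f e))\<rparr>"

definition mor_eq ::
  "('v, 'e, 'g) gog \<Rightarrow> ('v, 'e, 'g, 'w, 'd, 'k) gog_mor \<Rightarrow>
   ('v, 'e, 'g, 'w, 'd, 'k) gog_mor \<Rightarrow> bool" where
  "mor_eq L f f' \<longleftrightarrow>
     (\<forall>v\<in>gverts L. on_v f v = on_v f' v \<and>
        (\<forall>g\<in>carrier (vgrp L v). hom_v f v g = hom_v f' v g)) \<and>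
     (\<forall>e\<in>garcs L. on_e f e = on_e f' e \<and> delta f e = delta f' e \<and>
        (\<forall>h\<in>carrier (egrp L e). hom_e f e h = hom_e f' e h))"

text \<open>The sense in which two morphisms pointed at \<open>p\<close> agree when a square is said to commute: the
  underlying graph morphisms are equal, and the group data differ by a change of reference
  elements \<open>k\<close>, \<open>l\<close> in the target groups that is trivial at the base vertex \<open>p\<close>. (This is homotopy
  of morphisms of complexes of groups, as in Bridson and Haefliger, chapter III.C.) The actions
  on paths are then related by \<open>f' \<gamma> = k u \<cdot> f \<gamma> \<cdot> (k v)\<inverse>\<close> up to path homotopy, for \<open>\<gamma>\<close> from \<open>u\<close> to
  \<open>v\<close>; in particular \<open>f\<close> and \<open>f'\<close> act equally on homotopy classes of loops at \<open>p\<close>.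

  Requiring \<open>mor_eq\<close> instead would be too strict for the square of covering projections: these are
  normalised by coset representatives, whereas the elements \<open>delta f e\<close> are arbitrary. For
  instance, let \<open>f\<close> be the identity of a graph with one edge and two vertices, the target having
  trivial groups except at \<open>ghead e\<close>, the source trivial groups, and let \<open>delta f e \<noteq> 1\<close>.\<close>

definition pointed_mor_equiv ::
  "('v, 'e, 'g) gog \<Rightarrow> ('w, 'd, 'k) gog \<Rightarrow> 'v \<Rightarrow> ('v, 'e, 'g, 'w, 'd, 'k) gog_mor \<Rightarrow>
   ('v, 'e, 'g, 'w, 'd, 'k) gog_mor \<Rightarrow> bool" where
  "pointed_mor_equiv L G p f f' \<longleftrightarrow>
     (\<forall>v\<in>gverts L. on_v f' v = on_v f v) \<and> (\<forall>e\<in>garcs L. on_e f' e = on_e f e) \<and>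
     (\<exists>k l. k p = \<one>\<^bsub>vgrp G (on_v f p)\<^esub> \<and>
        (\<forall>v\<in>gverts L. let M = vgrp G (on_v f v) in
           k v \<in> carrier M \<and>
           (\<forall>g\<in>carrier (vgrp L v). hom_v f' v g = k v \<otimes>\<^bsub>M\<^esub> hom_v f v g \<otimes>\<^bsub>M\<^esub> inv\<^bsub>M\<^esub> (k v))) \<and>
        (\<forall>e\<in>garcs L. let M = vgrp G (on_v f (ghead L e)); N = cell_grp G (on_e f e) in
           l e \<in> carrier N \<and> l (opp L e) = l e \<and>
           (\<forall>h\<in>carrier (egrp L e). hom_e f' e h = l e \<otimes>\<^bsub>N\<^esub> hom_e f e h \<otimes>\<^bsub>N\<^esub> inv\<^bsub>N\<^esub> (l e)) \<and>
           delta f' e =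
             k (ghead L e) \<otimes>\<^bsub>M\<^esub> delta f e \<otimes>\<^bsub>M\<^esub> inv\<^bsub>M\<^esub> (cell_inc G (on_e f e) (l e))))"


section \<open>Paths and homotopy\<close>

text \<open>\<open>Elt v g\<close> is a group element \<open>g\<close> inserted at the vertex \<open>v\<close>. Several elements (or none) may
  be inserted at the same passage through a vertex; homotopy allows to multiply them.\<close>

datatype ('v, 'e, 'g) letter = Elt 'v 'g | Arc 'e

fun gpath :: "('v, 'e, 'g) gog \<Rightarrow> 'v \<Rightarrow> ('v, 'e, 'g) letter list \<Rightarrow> 'v \<Rightarrow> bool" where
  "gpath G u [] v \<longleftrightarrow> u \<in> gverts G \<and> u = v"
| "gpath G u (Elt w g # \<gamma>) v \<longleftrightarrow> w = u \<and> g \<in> carrier (vgrp G u) \<and> gpath G u \<gamma> v"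
| "gpath G u (Arc e # \<gamma>) v \<longleftrightarrow> e \<in> garcs G \<and> gtail G e = u \<and> gpath G (ghead G e) \<gamma> v"

fun letter_rev :: "('v, 'e, 'g) gog \<Rightarrow> ('v, 'e, 'g) letter \<Rightarrow> ('v, 'e, 'g) letter" where
  "letter_rev G (Elt v g) = Elt v (inv\<^bsub>vgrp G v\<^esub> g)"
| "letter_rev G (Arc e) = Arc (opp G e)"

definition path_rev ::
  "('v, 'e, 'g) gog \<Rightarrow> ('v, 'e, 'g) letter list \<Rightarrow> ('v, 'e, 'g) letter list" where
  "path_rev G \<gamma> = rev (map (letter_rev G) \<gamma>)"

inductive homotopic ::
  "('v, 'e, 'g) gog \<Rightarrow> 'v \<Rightarrow> 'v \<Rightarrow> ('v, 'e, 'g) letter list \<Rightarrow> ('v, 'e, 'g) letter list \<Rightarrow> bool"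
  for G u v where
  refl: "gpath G u \<gamma> v \<Longrightarrow> homotopic G u v \<gamma> \<gamma>"
| sym: "homotopic G u v \<gamma> \<gamma>' \<Longrightarrow> homotopic G u v \<gamma>' \<gamma>"
| trans: "homotopic G u v \<gamma> \<gamma>' \<Longrightarrow> homotopic G u v \<gamma>' \<gamma>'' \<Longrightarrow> homotopic G u v \<gamma> \<gamma>''"
| mult: "gpath G u (\<alpha> @ [Elt w g, Elt w g'] @ \<beta>) v \<Longrightarrow>
    homotopic G u v (\<alpha> @ [Elt w g, Elt w g'] @ \<beta>) (\<alpha> @ [Elt w (g \<otimes>\<^bsub>vgrp G w\<^esub> g')] @ \<beta>)"
| one: "gpath G u (\<alpha> @ [Elt w \<one>\<^bsub>vgrp G w\<^esub>] @ \<beta>) v \<Longrightarrow>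
    homotopic G u v (\<alpha> @ [Elt w \<one>\<^bsub>vgrp G w\<^esub>] @ \<beta>) (\<alpha> @ \<beta>)"
| backtrack: "gpath G u (\<alpha> @ \<sigma> @ path_rev G \<sigma> @ \<beta>) v \<Longrightarrow>
    homotopic G u v (\<alpha> @ \<sigma> @ path_rev G \<sigma> @ \<beta>) (\<alpha> @ \<beta>)"
| slide: "gpath G u (\<alpha> @ [Arc e, Elt (ghead G e) (inc G e h)] @ \<beta>) v \<Longrightarrow> h \<in> carrier (egrp G e) \<Longrightarrow>
    homotopic G u v (\<alpha> @ [Arc e, Elt (ghead G e) (inc G e h)] @ \<beta>)
                    (\<alpha> @ [Elt (gtail G e) (inc G (opp G e) h), Arc e] @ \<beta>)"


section \<open>The Bass--Serre tree\<close>

type_synonym ('v, 'e, 'g) bs_v = "'v \<times> ('v, 'e, 'g) letter list set"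
type_synonym ('v, 'e, 'g) bs_e = "'e \<times> ('v, 'e, 'g) letter list set"

definition bs_vertex ::
  "('v, 'e, 'g) gog \<Rightarrow> 'v \<Rightarrow> 'v \<Rightarrow> ('v, 'e, 'g) letter list \<Rightarrow> ('v, 'e, 'g) bs_v" where
  "bs_vertex G q v \<gamma> = (v, {\<gamma>'. \<exists>g\<in>carrier (vgrp G v). homotopic G q v \<gamma>' (\<gamma> @ [Elt v g])})"

definition bs_arc ::
  "('v, 'e, 'g) gog \<Rightarrow> 'v \<Rightarrow> 'e \<Rightarrow> ('v, 'e, 'g) letter list \<Rightarrow> ('v, 'e, 'g) bs_e" where
  "bs_arc G q e \<gamma> =
     (e, {\<gamma>'. \<exists>h\<in>carrier (egrp G e).
           homotopic G q (gtail G e) \<gamma>' (\<gamma> @ [Elt (gtail G e) (inc G (opp G e) h)])})"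

text \<open>The tree is an ordinary graph, that is, a graph of trivial groups. The choice of a
  representative \<open>SOME \<gamma>. \<gamma> \<in> C\<close> of a class does not matter.\<close>

definition bs_tree ::
  "('v, 'e, 'g) gog \<Rightarrow> 'v \<Rightarrow> (('v, 'e, 'g) bs_v, ('v, 'e, 'g) bs_e, unit) gog" where
  "bs_tree G q =
     (let A = {bs_arc G q e \<gamma> |e \<gamma>. e \<in> garcs G \<and> gpath G q \<gamma> (gtail G e)} in
      \<lparr>graph =
         \<lparr>verts = {bs_vertex G q v \<gamma> |v \<gamma>. gpath G q \<gamma> v},
          arcs = A,
          tail = (\<lambda>(e, C). bs_vertex G q (gtail G e) (SOME \<gamma>. \<gamma> \<in> C)),
          head = (\<lambda>(e, C). bs_vertex G q (ghead G e) ((SOME \<gamma>. \<gamma> \<in> C) @ [Arc e]))\<rparr>,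
       opp = (\<lambda>(e, C). if (e, C) \<in> A then bs_arc G q (opp G e) ((SOME \<gamma>. \<gamma> \<in> C) @ [Arc e])
                       else (e, C)),
       vgrp = (\<lambda>_. singleton_group ()),
       egrp = (\<lambda>_. singleton_group ()),
       inc = (\<lambda>_ x. x)\<rparr>)"

definition bs_base :: "('v, 'e, 'g) gog \<Rightarrow> 'v \<Rightarrow> ('v, 'e, 'g) bs_v" where
  "bs_base G q = bs_vertex G q q []"


section \<open>The covering projection\<close>

definition transversal :: "('v, 'e, 'g) gog \<Rightarrow> ('e \<Rightarrow> 'g set) \<Rightarrow> bool" where
  "transversal G S \<longleftrightarrow>
     (\<forall>e\<in>garcs G. let M = vgrp G (ghead G e) in
        S e \<subseteq> carrier M \<and> \<one>\<^bsub>M\<^esub> \<in> S e \<and>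
        (\<forall>g\<in>carrier M. \<exists>!s. s \<in> S e \<and> g \<in> s <#\<^bsub>M\<^esub> (inc G e ` carrier (egrp G e))))"

definition tight_path :: "('v, 'e, 'g) gog \<Rightarrow> 'v \<Rightarrow> 'e list \<Rightarrow> 'v \<Rightarrow> bool" where
  "tight_path T u xs v \<longleftrightarrow>
     pre_digraph.awalk (graph T) u xs v \<and> successively (\<lambda>x y. y \<noteq> opp T x) xs"

text \<open>The list \<open>[(s\<^sub>1, e\<^sub>1), \<dots>, (s\<^sub>k, e\<^sub>k)]\<close> stands for the path \<open>s\<^sub>1 e\<^sub>1 \<dots> s\<^sub>k e\<^sub>k 1\<close>.\<close>

definition normal_form ::
  "('v, 'e, 'g) gog \<Rightarrow> ('e \<Rightarrow> 'g set) \<Rightarrow> 'v \<Rightarrow> ('g \<times> 'e) list \<Rightarrow> bool" where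
  "normal_form G S q ns \<longleftrightarrow>
     (\<exists>v. pre_digraph.awalk (graph G) q (map snd ns) v) \<and>
     (\<forall>(s, e)\<in>set ns. s \<in> S (opp G e)) \<and>
     successively (\<lambda>(s, e) (s', e'). s' = \<one>\<^bsub>vgrp G (gtail G e')\<^esub> \<longrightarrow> e \<noteq> opp G e') ns"

text \<open>The arcs of the tree traversed by the lift of \<open>\<gamma> s\<^sub>1 e\<^sub>1 \<dots> s\<^sub>k e\<^sub>k\<close> after the lift of \<open>\<gamma>\<close>.\<close>

fun lift_arcs ::
  "('v, 'e, 'g) gog \<Rightarrow> 'v \<Rightarrow> ('v, 'e, 'g) letter list \<Rightarrow> ('g \<times> 'e) list \<Rightarrow> ('v, 'e, 'g) bs_e list"
where
  "lift_arcs G q \<gamma> [] = []"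
| "lift_arcs G q \<gamma> ((s, e) # ns) =
     bs_arc G q e (\<gamma> @ [Elt (gtail G e) s]) # lift_arcs G q (\<gamma> @ [Elt (gtail G e) s, Arc e]) ns"

definition cov_delta ::
  "('v, 'e, 'g) gog \<Rightarrow> ('e \<Rightarrow> 'g set) \<Rightarrow> 'v \<Rightarrow> ('v, 'e, 'g) bs_e \<Rightarrow> 'g" where
  "cov_delta G S q x =
     (let T = bs_tree G q; y = opp T x;
          xs = (THE xs. tight_path T (bs_base G q) xs (ghead T y))
      in if xs \<noteq> [] \<and> last xs = y
         then fst (last (THE ns. normal_form G S q ns \<and> lift_arcs G q [] ns = xs))
         else \<one>\<^bsub>vgrp G (ghead G (fst x))\<^esub>)"

definition cov_proj ::
  "('v, 'e, 'g) gog \<Rightarrow> ('e \<Rightarrow> 'g set) \<Rightarrow> 'v \<Rightarrow>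
   (('v, 'e, 'g) bs_v, ('v, 'e, 'g) bs_e, unit, 'v, 'e, 'g) gog_mor" where
  "cov_proj G S q =
     \<lparr>on_v = fst,
      on_e = (\<lambda>x. Inr (fst x)),
      hom_v = (\<lambda>x _. \<one>\<^bsub>vgrp G (fst x)\<^esub>),
      hom_e = (\<lambda>x _. \<one>\<^bsub>egrp G (fst x)\<^esub>),
      delta = cov_delta G S q\<rparr>"


section \<open>Lifting a morphism\<close>

definition is_lift ::
  "('v, 'e, 'g) gog \<Rightarrow> ('e \<Rightarrow> 'g set) \<Rightarrow> ('w, 'd, 'k) gog \<Rightarrow> ('d \<Rightarrow> 'k set) \<Rightarrow>
   ('v, 'e, 'g, 'w, 'd, 'k) gog_mor \<Rightarrow> 'v \<Rightarrow>
   (('v, 'e, 'g) bs_v, ('v, 'e, 'g) bs_e, unit, ('w, 'd, 'k) bs_v, ('w, 'd, 'k) bs_e, unit) gog_mor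
   \<Rightarrow> bool" where
  "is_lift L S G R f p F \<longleftrightarrow>
     (let q = on_v f p; TL = bs_tree L p; TG = bs_tree G q in
        gog_morphism TL TG F \<and>
        on_v F (bs_base L p) = bs_base G q \<and>
        pointed_mor_equiv TL G (bs_base L p)
          (mor_comp TL G f (cov_proj L S p))
          (mor_comp TL G (cov_proj G R q) F))"

definition has_unique_lift ::
  "('v, 'e, 'g) gog \<Rightarrow> ('w, 'd, 'k) gog \<Rightarrow> ('v, 'e, 'g, 'w, 'd, 'k) gog_mor \<Rightarrow> 'v \<Rightarrow> bool" where
  "has_unique_lift L G f p \<longleftrightarrow>
     (\<forall>S R. transversal L S \<and> transversal G R \<longrightarrow>
        (\<exists>F. is_lift L S G R f p F) \<and>
        (\<forall>F F'. is_lift L S G R f p F \<and> is_lift L S G R f p F' \<longrightarrow> mor_eq (bs_tree L p) F F'))"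


section \<open>Declaring interior points of edges to be vertices\<close>

text \<open>\<open>subdivide_at G A\<close> declares one interior point of each edge in \<open>A\<close> (a set of arcs closed under
  \<open>opp\<close>) to be a vertex, with vertex group the edge group. The new vertex on the edge formed by
  \<open>e\<close> and \<open>opp G e\<close> is \<open>Mid {e, opp G e}\<close>; the arc \<open>e\<close> becomes \<open>Initial e\<close>, which ends there,
  followed by \<open>Terminal e\<close>.\<close>

datatype ('v, 'e) sub_v = Old 'v | Mid "'e set"
datatype 'e sub_e = Whole 'e | Initial 'e | Terminal 'e

definition subdivide_at ::
  "('v, 'e, 'g) gog \<Rightarrow> 'e set \<Rightarrow> (('v, 'e) sub_v, 'e sub_e, 'g) gog" where
  "subdivide_at G A =
     \<lparr>graph =
        \<lparr>verts = Old ` gverts G \<union> (\<lambda>e. Mid {e, opp G e}) ` A,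
         arcs = Whole ` (garcs G - A) \<union> Initial ` A \<union> Terminal ` A,
         tail = (\<lambda>x. case x of Whole e \<Rightarrow> Old (gtail G e) | Initial e \<Rightarrow> Old (gtail G e)
                             | Terminal e \<Rightarrow> Mid {e, opp G e}),
         head = (\<lambda>x. case x of Whole e \<Rightarrow> Old (ghead G e) | Initial e \<Rightarrow> Mid {e, opp G e}
                             | Terminal e \<Rightarrow> Old (ghead G e))\<rparr>,
      opp = (\<lambda>x. case x of Whole e \<Rightarrow> (if e \<in> A then Whole e else Whole (opp G e))
                         | Initial e \<Rightarrow> (if e \<in> A then Terminal (opp G e) else Initial e)
                         | Terminal e \<Rightarrow> (if e \<in> A then Initial (opp G e) else Terminal e)),
      vgrp = (\<lambda>v. case v of Old w \<Rightarrow> vgrp G w | Mid m \<Rightarrow> egrp G (SOME e. e \<in> m)),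
      egrp = (\<lambda>x. case x of Whole e \<Rightarrow> egrp G e | Initial e \<Rightarrow> egrp G e | Terminal e \<Rightarrow> egrp G e),
      inc = (\<lambda>x. case x of Whole e \<Rightarrow> inc G e | Initial e \<Rightarrow> (\<lambda>h. h) | Terminal e \<Rightarrow> inc G e)\<rparr>"

text \<open>The same morphism, viewed on subdivided graphs; the arcs subdivided in the source have to
  include all those which map to arcs subdivided in the target, and otherwise only collapsed
  ones.\<close>

definition subdivide_mor ::
  "('w, 'd, 'k) gog \<Rightarrow> ('v, 'e, 'g, 'w, 'd, 'k) gog_mor \<Rightarrow>
   (('v, 'e) sub_v, 'e sub_e, 'g, ('w, 'd) sub_v, 'd sub_e, 'k) gog_mor" where
  "subdivide_mor G f =
     \<lparr>on_v = (\<lambda>v. case v of Old u \<Rightarrow> Old (on_v f u)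
                | Mid m \<Rightarrow> (case on_e f (SOME e. e \<in> m) of Inl w \<Rightarrow> Old w
                                                       | Inr d \<Rightarrow> Mid {d, opp G d})),
      on_e = (\<lambda>x. case x of Whole e \<Rightarrow> map_sum Old Whole (on_e f e)
                          | Initial e \<Rightarrow> map_sum Old Initial (on_e f e)
                          | Terminal e \<Rightarrow> map_sum Old Terminal (on_e f e)),
      hom_v = (\<lambda>v. case v of Old u \<Rightarrow> hom_v f u | Mid m \<Rightarrow> hom_e f (SOME e. e \<in> m)),
      hom_e = (\<lambda>x. case x of Whole e \<Rightarrow> hom_e f e | Initial e \<Rightarrow> hom_e f e | Terminal e \<Rightarrow> hom_e f e),
      delta = (\<lambda>x. case x of Whole e \<Rightarrow> delta f e
                           | Initial e \<Rightarrow> \<one>\<^bsub>cell_grp G (on_e f e)\<^esub>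
                           | Terminal e \<Rightarrow> delta f e)\<rparr>"

text \<open>For a base point \<open>p\<close> interior to the edge of \<open>e\<close>, the arcs to be subdivided: in the target
  the arcs containing \<open>q = f p\<close> (none if \<open>e\<close> is collapsed), in the source those containing \<open>p\<close> or
  another preimage of \<open>q\<close> interior to an uncollapsed edge.\<close>

definition target_cut ::
  "('w, 'd, 'k) gog \<Rightarrow> ('v, 'e, 'g, 'w, 'd, 'k) gog_mor \<Rightarrow> 'e \<Rightarrow> 'd set" where
  "target_cut G f e = (case on_e f e of Inl _ \<Rightarrow> {} | Inr d \<Rightarrow> {d, opp G d})"

definition source_cut ::
  "('v, 'e, 'g) gog \<Rightarrow> ('w, 'd, 'k) gog \<Rightarrow> ('v, 'e, 'g, 'w, 'd, 'k) gog_mor \<Rightarrow> 'e \<Rightarrow> 'e set" where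
  "source_cut L G f e = {e, opp L e} \<union> {x \<in> garcs L. on_e f x \<in> Inr ` target_cut G f e}"

end

theory Submission
  imports Defs
begin

text \<open>Fix transversals. Every path from the base point has a normal form
  \<open>s\<^sub>1 e\<^sub>1 \<dots> s\<^sub>k e\<^sub>k a\<close>. The letters of paths act on normal forms, and a letter and its inverse act by
  inverse maps, so that homotopic paths have equal normal forms (van der Waerden's argument) and
  vertices of the tree are the sequences \<open>(s\<^sub>1, e\<^sub>1), \<dots>, (s\<^sub>k, e\<^sub>k)\<close>. For an arc \<open>y\<close> of the tree,
  the element \<open>\<delta>\<close> of the covering projection at the reverse of \<open>y\<close> is the coset representative of
  the last element \<open>a\<close> of any path representing \<open>y\<close>.

  The lift sends the vertex represented by a path to the vertex represented by its image. If the
  image of the normal form \<open>s\<^sub>1 e\<^sub>1 \<dots> s\<^sub>k e\<^sub>k\<close> of a vertex \<open>x\<close> has itself the normal form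
  \<open>t\<^sub>1 d\<^sub>1 \<dots> t\<^sub>m d\<^sub>m b\<close>, then \<open>k x = b\<close> is the change of reference element at \<open>x\<close>. Conversely, along
  an arc leaving \<open>x\<close>, commutativity of the square and the value \<open>k x\<close> determine the image of the arc
  and the value of \<open>k\<close> at its other end, so that the lift is unique by induction along tight paths.\<close>

lemma (in pre_digraph) awalk_snoc_iff:
  "awalk u (p @ [e]) v \<longleftrightarrow> awalk u p (tail G e) \<and> e \<in> arcs G \<and> head G e = v"
proof -
  have "cas u (p @ [e]) v \<longleftrightarrow> cas u p (tail G e) \<and> head G e = v"
    by (induction p arbitrary: u) auto
  then show ?thesis by (auto simp: awalk_def)
qed

lemma (in pre_digraph) cas_unique: "cas u p v \<Longrightarrow> cas u p v' \<Longrightarrow> v = v'"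
  by (induction p arbitrary: u) auto

lemma successively_snoc_iff:
  "successively P (xs @ [x]) \<longleftrightarrow> successively P xs \<and> (xs \<noteq> [] \<longrightarrow> P (last xs) x)"
  by (auto simp: successively_append_iff)

section \<open>Paths and homotopy\<close>

text \<open>The conditions on groups and incidence that pass to subdivisions
  (\<open>gog_data_subdivide_at\<close>), so that one argument serves base points at vertices and
  inside edges.\<close>

locale gog_data =
  fixes G :: "('v, 'e, 'g) gog"
  assumes bidirected: "bidirected_digraph (graph G) (opp G)"
    and group_vgrp: "v \<in> gverts G \<Longrightarrow> group (vgrp G v)"
    and group_egrp: "e \<in> garcs G \<Longrightarrow> group (egrp G e)"
    and egrp_opp: "e \<in> garcs G \<Longrightarrow> egrp G (opp G e) = egrp G e"
    and inc_mon: "e \<in> garcs G \<Longrightarrow> inc G e \<in> mon (egrp G e) (vgrp G (ghead G e))"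

lemma graph_of_groups_imp_gog_data: "graph_of_groups G \<Longrightarrow> gog_data G"
  by (auto simp: graph_of_groups_def gog_data_def)

sublocale gog_data \<subseteq> bidirected_digraph "graph G" "opp G"
  by (rule bidirected)

lemma path_rev_simps [simp]:
  "path_rev G [] = []"
  "path_rev G (x # \<sigma>) = path_rev G \<sigma> @ [letter_rev G x]"
  "path_rev G (\<sigma> @ \<tau>) = path_rev G \<tau> @ path_rev G \<sigma>"
  by (auto simp: path_rev_def)

context gog_data
begin

lemma inc_hom: "e \<in> garcs G \<Longrightarrow> inc G e \<in> hom (egrp G e) (vgrp G (ghead G e))"
  and inc_inj: "e \<in> garcs G \<Longrightarrow> inj_on (inc G e) (carrier (egrp G e))"
  using inc_mon by (auto simp: mon_def)

lemma inc_closed: "e \<in> garcs G \<Longrightarrow> h \<in> carrier (egrp G e) \<Longrightarrow> inc G e h \<in> carrier (vgrp G (ghead G e))"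
  using inc_hom by (blast intro: hom_in_carrier)

lemma inc_opp_closed:
  "e \<in> garcs G \<Longrightarrow> h \<in> carrier (egrp G e) \<Longrightarrow> inc G (opp G e) h \<in> carrier (vgrp G (gtail G e))"
  using inc_closed[of "opp G e" h] by (simp add: egrp_opp)

lemma inc_mult:
  "e \<in> garcs G \<Longrightarrow> h \<in> carrier (egrp G e) \<Longrightarrow> h' \<in> carrier (egrp G e) \<Longrightarrow>
   inc G e (h \<otimes>\<^bsub>egrp G e\<^esub> h') = inc G e h \<otimes>\<^bsub>vgrp G (ghead G e)\<^esub> inc G e h'"
  using inc_hom by (blast intro: hom_mult)

lemma inc_one: "e \<in> garcs G \<Longrightarrow> inc G e \<one>\<^bsub>egrp G e\<^esub> = \<one>\<^bsub>vgrp G (ghead G e)\<^esub>"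
  using inc_hom group_egrp group_vgrp by (intro hom_one) auto

lemma gpath_verts: "gpath G u \<gamma> v \<Longrightarrow> u \<in> gverts G \<and> v \<in> gverts G"
proof (induction \<gamma> arbitrary: u)
  case (Cons x \<gamma>)
  then show ?case by (cases x) auto
qed simp

lemma gpath_append: "gpath G u (\<alpha> @ \<beta>) v \<longleftrightarrow> (\<exists>w. gpath G u \<alpha> w \<and> gpath G w \<beta> v)"
proof (induction \<alpha> arbitrary: u)
  case Nil
  then show ?case using gpath_verts by auto
next
  case (Cons x \<alpha>)
  then show ?case by (cases x) auto
qed

lemma gpath_appendI: "gpath G u \<alpha> w \<Longrightarrow> gpath G w \<beta> v \<Longrightarrow> gpath G u (\<alpha> @ \<beta>) v"
  by (auto simp: gpath_append)

lemma gpath_rev: "gpath G u \<sigma> v \<Longrightarrow> gpath G v (path_rev G \<sigma>) u"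
proof (induction \<sigma> arbitrary: u)
  case (Cons x \<sigma>)
  show ?case
  proof (cases x)
    case (Elt w g)
    moreover have "group (vgrp G u)"
      using Cons.prems gpath_verts group_vgrp by blast
    ultimately show ?thesis
      using Cons gpath_verts[OF Cons.prems] by (auto intro!: gpath_appendI group.inv_closed)
  next
    case (Arc e)
    then show ?thesis using Cons by (auto intro!: gpath_appendI)
  qed
qed auto

lemma homotopic_gpath: "homotopic G u v \<gamma> \<gamma>' \<Longrightarrow> gpath G u \<gamma> v \<and> gpath G u \<gamma>' v"
proof (induction rule: homotopic.induct)
  case (mult \<alpha> w g g' \<beta>)
  then show ?case
    using gpath_verts group_vgrp by (fastforce simp: gpath_append intro!: monoid.m_closed group.is_monoid)
next
  case (one \<alpha> w \<beta>)
  then show ?case by (auto simp: gpath_append)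
next
  case (backtrack \<alpha> \<sigma> \<beta>)
  then obtain w z z' where w: "gpath G u \<alpha> w" "gpath G w \<sigma> z" "gpath G z (path_rev G \<sigma>) z'" "gpath G z' \<beta> v"
    by (auto simp: gpath_append)
  \<comment> \<open>A path determines its end, so after deleting the backtrack
    \<open>\<alpha>\<close> and \<open>\<beta>\<close> meet at one vertex.\<close>
  have eq: "z' = w" if "gpath G z \<rho> w" "gpath G z \<rho> z'" for z \<rho>
    using that
  proof (induction \<rho> arbitrary: z)
    case (Cons x \<rho>)
    then show ?case by (cases x) auto
  qed simp
  show ?case
    using backtrack w eq[OF gpath_rev[OF w(2)] w(3)] by (auto simp: gpath_append)
next
  case (slide \<alpha> e h \<beta>)
  then show ?case by (auto simp: gpath_append inc_opp_closed intro!: exI[of _ "gtail G e"])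
qed auto

text \<open>Every generating move carries its own context, which absorbs the prefix and the
  suffix.\<close>

lemma homotopic_append:
  assumes "homotopic G u v \<gamma> \<gamma>'" "gpath G w \<alpha> u" "gpath G v \<beta> z"
  shows "homotopic G w z (\<alpha> @ \<gamma> @ \<beta>) (\<alpha> @ \<gamma>' @ \<beta>)"
  using assms
proof (induction rule: homotopic.induct)
  case (refl \<gamma>)
  then show ?case by (intro homotopic.refl gpath_appendI)
next
  case (sym \<gamma> \<gamma>')
  then show ?case by (blast intro: homotopic.sym)
next
  case (trans \<gamma> \<gamma>' \<gamma>'')
  then show ?case by (blast intro: homotopic.trans)
next
  case (mult \<alpha>' x g g' \<beta>')
  have "gpath G w ((\<alpha> @ \<alpha>') @ [Elt x g, Elt x g'] @ \<beta>' @ \<beta>) z"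
    using gpath_appendI[OF mult.prems(1) gpath_appendI[OF mult.hyps mult.prems(2)]] by simp
  from homotopic.mult[OF this] show ?case by simp
next
  case (one \<alpha>' x \<beta>')
  have "gpath G w ((\<alpha> @ \<alpha>') @ [Elt x \<one>\<^bsub>vgrp G x\<^esub>] @ \<beta>' @ \<beta>) z"
    using gpath_appendI[OF one.prems(1) gpath_appendI[OF one.hyps one.prems(2)]] by simp
  from homotopic.one[OF this] show ?case by simp
next
  case (backtrack \<alpha>' \<sigma> \<beta>')
  have "gpath G w ((\<alpha> @ \<alpha>') @ \<sigma> @ path_rev G \<sigma> @ \<beta>' @ \<beta>) z"
    using gpath_appendI[OF backtrack.prems(1) gpath_appendI[OF backtrack.hyps backtrack.prems(2)]] by simp
  from homotopic.backtrack[OF this] show ?case by simp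
next
  case (slide \<alpha>' e h \<beta>')
  have "gpath G w ((\<alpha> @ \<alpha>') @ [Arc e, Elt (ghead G e) (inc G e h)] @ \<beta>' @ \<beta>) z"
    using gpath_appendI[OF slide.prems(1) gpath_appendI[OF slide.hyps(1) slide.prems(2)]] by simp
  from homotopic.slide[OF this slide.hyps(2)] show ?case by simp
qed

end

section \<open>Normal forms\<close>

locale gog_cover = gog_data G for G :: "('v, 'e, 'g) gog" +
  fixes S :: "'e \<Rightarrow> 'g set" and q :: 'v
  assumes transversal: "transversal G S" and base_vertex: "q \<in> gverts G"
begin

section \<open>Coset representatives and edge group factors\<close>

definition rep :: "'e \<Rightarrow> 'g \<Rightarrow> 'g" where
  "rep e g = (THE s. s \<in> S e \<and> g \<in> s <#\<^bsub>vgrp G (ghead G e)\<^esub> (inc G e ` carrier (egrp G e)))"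

definition res :: "'e \<Rightarrow> 'g \<Rightarrow> 'g" where
  "res e g = (THE h. h \<in> carrier (egrp G e) \<and> g = rep e g \<otimes>\<^bsub>vgrp G (ghead G e)\<^esub> inc G e h)"

lemma transversalD:
  assumes "e \<in> garcs G"
  shows "S e \<subseteq> carrier (vgrp G (ghead G e))" "\<one>\<^bsub>vgrp G (ghead G e)\<^esub> \<in> S e"
    "g \<in> carrier (vgrp G (ghead G e)) \<Longrightarrow>
     \<exists>!s. s \<in> S e \<and> g \<in> s <#\<^bsub>vgrp G (ghead G e)\<^esub> (inc G e ` carrier (egrp G e))"
  using transversal assms unfolding transversal_def Let_def by auto

text \<open>The factorization into a representative and an edge group element is unique: the coset
  determines \<open>s\<close>, and injectivity of \<open>inc G e\<close> then determines
  \<open>h\<close>.\<close>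

lemma rep_res_eqI:
  assumes e: "e \<in> garcs G" and s: "s \<in> S e" and h: "h \<in> carrier (egrp G e)"
  shows "rep e (s \<otimes>\<^bsub>vgrp G (ghead G e)\<^esub> inc G e h) = s"
    and "res e (s \<otimes>\<^bsub>vgrp G (ghead G e)\<^esub> inc G e h) = h"
proof -
  interpret M: group "vgrp G (ghead G e)" using e group_vgrp by simp
  have sc: "s \<in> carrier (vgrp G (ghead G e))" using transversalD(1)[OF e] s by auto
  let ?g = "s \<otimes>\<^bsub>vgrp G (ghead G e)\<^esub> inc G e h"
  have g: "?g \<in> carrier (vgrp G (ghead G e))" using sc inc_closed[OF e h] by simp
  have "?g \<in> s <#\<^bsub>vgrp G (ghead G e)\<^esub> (inc G e ` carrier (egrp G e))"
    using h by (auto simp: l_coset_def)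
  then show 1: "rep e ?g = s"
    unfolding rep_def using transversalD(3)[OF e g] s by (intro the1_equality) auto
  show "res e ?g = h"
    unfolding res_def 1
  proof (rule the_equality)
    fix h' assume h': "h' \<in> carrier (egrp G e) \<and> ?g = s \<otimes>\<^bsub>vgrp G (ghead G e)\<^esub> inc G e h'"
    then have "inc G e h = inc G e h'"
      using sc inc_closed[OF e] h by (metis M.Units_eq M.Units_l_cancel)
    then show "h' = h" using inc_inj[OF e] h h' by (auto dest: inj_onD)
  qed (use h in auto)
qed

lemma rep_res:
  assumes e: "e \<in> garcs G" and g: "g \<in> carrier (vgrp G (ghead G e))"
  shows "rep e g \<in> S e" "rep e g \<in> carrier (vgrp G (ghead G e))" "res e g \<in> carrier (egrp G e)"
    "rep e g \<otimes>\<^bsub>vgrp G (ghead G e)\<^esub> inc G e (res e g) = g"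
proof -
  obtain s h where s: "s \<in> S e" "h \<in> carrier (egrp G e)" "g = s \<otimes>\<^bsub>vgrp G (ghead G e)\<^esub> inc G e h"
    using transversalD(3)[OF e g] by (auto simp: l_coset_def)
  show "rep e g \<in> S e" "rep e g \<in> carrier (vgrp G (ghead G e))" "res e g \<in> carrier (egrp G e)"
    "rep e g \<otimes>\<^bsub>vgrp G (ghead G e)\<^esub> inc G e (res e g) = g"
    using rep_res_eqI[OF e s(1,2)] s transversalD(1)[OF e] by auto
qed

lemma rep_res_transversal:
  assumes e: "e \<in> garcs G" and s: "s \<in> S e"
  shows "rep e s = s" "res e s = \<one>\<^bsub>egrp G e\<^esub>"
proof -
  interpret M: group "vgrp G (ghead G e)" using e group_vgrp by simp
  have "s \<in> carrier (vgrp G (ghead G e))" using transversalD(1)[OF e] s by auto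
  then show "rep e s = s" "res e s = \<one>\<^bsub>egrp G e\<^esub>"
    using rep_res_eqI[OF e s group.is_monoid[OF group_egrp[OF e], THEN monoid.one_closed]]
    by (auto simp: inc_one e)
qed

lemma rep_res_mult_inc:
  assumes e: "e \<in> garcs G" and g: "g \<in> carrier (vgrp G (ghead G e))" and h: "h \<in> carrier (egrp G e)"
  shows "rep e (g \<otimes>\<^bsub>vgrp G (ghead G e)\<^esub> inc G e h) = rep e g"
    and "res e (g \<otimes>\<^bsub>vgrp G (ghead G e)\<^esub> inc G e h) = res e g \<otimes>\<^bsub>egrp G e\<^esub> h"
proof -
  interpret M: group "vgrp G (ghead G e)" using e group_vgrp by simp
  interpret E: group "egrp G e" using e group_egrp by simp
  note r = rep_res[OF e g]
  have "g \<otimes>\<^bsub>vgrp G (ghead G e)\<^esub> inc G e h =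
      rep e g \<otimes>\<^bsub>vgrp G (ghead G e)\<^esub> inc G e (res e g) \<otimes>\<^bsub>vgrp G (ghead G e)\<^esub> inc G e h"
    using r(4) by simp
  also have "\<dots> = rep e g \<otimes>\<^bsub>vgrp G (ghead G e)\<^esub> inc G e (res e g \<otimes>\<^bsub>egrp G e\<^esub> h)"
    using r(2,3) h e by (simp add: inc_mult inc_closed M.m_assoc)
  finally have eq: "g \<otimes>\<^bsub>vgrp G (ghead G e)\<^esub> inc G e h =
    rep e g \<otimes>\<^bsub>vgrp G (ghead G e)\<^esub> inc G e (res e g \<otimes>\<^bsub>egrp G e\<^esub> h)" .
  show "rep e (g \<otimes>\<^bsub>vgrp G (ghead G e)\<^esub> inc G e h) = rep e g"
    "res e (g \<otimes>\<^bsub>vgrp G (ghead G e)\<^esub> inc G e h) = res e g \<otimes>\<^bsub>egrp G e\<^esub> h"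
    unfolding eq using rep_res_eqI[OF e r(1), of "res e g \<otimes>\<^bsub>egrp G e\<^esub> h"] r(3) h by auto
qed

text \<open>Elements of one coset differ by the quotient of their edge group factors
  \<open>res e g\<close> and \<open>res e g'\<close>.\<close>

lemma rep_eqE:
  assumes e: "e \<in> garcs G" and g: "g \<in> carrier (vgrp G (ghead G e))"
    and g': "g' \<in> carrier (vgrp G (ghead G e))" and eq: "rep e g = rep e g'"
  obtains h where "h \<in> carrier (egrp G e)" "g' = g \<otimes>\<^bsub>vgrp G (ghead G e)\<^esub> inc G e h"
proof -
  interpret M: group "vgrp G (ghead G e)" using e group_vgrp by simp
  interpret E: group "egrp G e" using e group_egrp by simp
  note r = rep_res[OF e g] and r' = rep_res[OF e g']
  let ?h = "inv\<^bsub>egrp G e\<^esub> res e g \<otimes>\<^bsub>egrp G e\<^esub> res e g'"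
  have h: "?h \<in> carrier (egrp G e)" using r r' by simp
  have "g \<otimes>\<^bsub>vgrp G (ghead G e)\<^esub> inc G e ?h =
      rep e g \<otimes>\<^bsub>vgrp G (ghead G e)\<^esub> inc G e (res e g) \<otimes>\<^bsub>vgrp G (ghead G e)\<^esub> inc G e ?h"
    using r(4) by simp
  also have "\<dots> = rep e g \<otimes>\<^bsub>vgrp G (ghead G e)\<^esub> inc G e (res e g \<otimes>\<^bsub>egrp G e\<^esub> ?h)"
    using r(2,3) h e by (simp add: inc_mult inc_closed M.m_assoc)
  also have "res e g \<otimes>\<^bsub>egrp G e\<^esub> ?h = res e g'"
    using r(3) r'(3) by (simp add: E.m_assoc[symmetric])
  also have "rep e g \<otimes>\<^bsub>vgrp G (ghead G e)\<^esub> inc G e (res e g') = g'"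
    using r'(4) eq by simp
  finally show thesis using that[OF h] by simp
qed

section \<open>Reduced words and crossing an edge\<close>

definition nform :: "'v \<Rightarrow> ('g \<times> 'e) list \<Rightarrow> bool" where
  "nform v ns \<longleftrightarrow> awalk q (map snd ns) v \<and> (\<forall>(s, e)\<in>set ns. s \<in> S (opp G e)) \<and>
     successively (\<lambda>(s, e) (s', e'). s' = \<one>\<^bsub>vgrp G (gtail G e')\<^esub> \<longrightarrow> e \<noteq> opp G e') ns"

lemma normal_form_iff: "normal_form G S q ns \<longleftrightarrow> (\<exists>v. nform v ns)"
  by (auto simp: normal_form_def nform_def)

lemma nform_Nil [simp]: "nform v [] \<longleftrightarrow> v = q"
  using base_vertex by (auto simp: nform_def awalk_Nil_iff)

text \<open>Reducedness compares only neighbouring entries, which makes induction from the right end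
  possible throughout.\<close>

lemma nform_snoc:
  "nform v (ns @ [(s, e)]) \<longleftrightarrow> nform (gtail G e) ns \<and> e \<in> garcs G \<and> ghead G e = v \<and>
     s \<in> S (opp G e) \<and> \<not> (ns \<noteq> [] \<and> s = \<one>\<^bsub>vgrp G (gtail G e)\<^esub> \<and> snd (last ns) = opp G e)"
  unfolding nform_def by (auto simp: awalk_snoc_iff successively_snoc_iff case_prod_beta simp del: awalk_append_iff)

lemma nform_verts: "nform v ns \<Longrightarrow> v \<in> gverts G"
  by (auto simp: nform_def)

text \<open>The effect of traversing \<open>e\<close> on normal forms followed by a coset representative. The
  normal form theorem amounts to this being undone by traversing \<open>opp G e\<close>.\<close>

definition flip :: "('g \<times> 'e) list \<Rightarrow> 'g \<Rightarrow> 'e \<Rightarrow> ('g \<times> 'e) list \<times> 'g" where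
  "flip ns s e =
     (if ns \<noteq> [] \<and> s = \<one>\<^bsub>vgrp G (gtail G e)\<^esub> \<and> snd (last ns) = opp G e
      then (butlast ns, fst (last ns)) else (ns @ [(s, e)], \<one>\<^bsub>vgrp G (ghead G e)\<^esub>))"

lemma flip_cases:
  assumes e: "e \<in> garcs G" and ns: "nform (gtail G e) ns" and s: "s \<in> S (opp G e)"
  obtains (pop) ns' s' where "ns = ns' @ [(s', opp G e)]" "s = \<one>\<^bsub>vgrp G (gtail G e)\<^esub>"
      "flip ns s e = (ns', s')" "nform (ghead G e) ns'" "s' \<in> S e"
  | (push) "nform (ghead G e) (ns @ [(s, e)])" "flip ns s e = (ns @ [(s, e)], \<one>\<^bsub>vgrp G (ghead G e)\<^esub>)"
proof (cases "ns \<noteq> [] \<and> s = \<one>\<^bsub>vgrp G (gtail G e)\<^esub> \<and> snd (last ns) = opp G e")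
  case True
  then obtain ns' s' where "ns = ns' @ [(s', opp G e)]"
    by (metis append_butlast_last_id prod.collapse)
  then show thesis using True ns e by (intro pop) (auto simp: flip_def nform_snoc)
next
  case False
  then show thesis using ns s e by (intro push) (auto simp: flip_def nform_snoc)
qed

text \<open>A pushed entry leaves \<open>1\<close> behind the arc \<open>e\<close>, so crossing back
  pops it. A popped entry is pushed again when crossing back, since a further cancellation would
  mean that the original word was not reduced.\<close>

lemma flip_flip:
  assumes e: "e \<in> garcs G" and ns: "nform (gtail G e) ns" and s: "s \<in> S (opp G e)"
    and f: "flip ns s e = (ns', t)"
  shows "nform (ghead G e) ns'" "t \<in> S e" "flip ns' t (opp G e) = (ns, s)"
proof -
  have "nform (ghead G e) ns' \<and> t \<in> S e \<and> flip ns' t (opp G e) = (ns, s)"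
    using e ns s
  proof (cases rule: flip_cases)
    case (pop ns' s')
    then show ?thesis using f ns e by (auto simp: nform_snoc flip_def)
  next
    case push
    then show ?thesis using f e transversalD(2)[OF e] by (auto simp: flip_def)
  qed
  then show "nform (ghead G e) ns'" "t \<in> S e" "flip ns' t (opp G e) = (ns, s)" by auto
qed

section \<open>Action of paths on normal forms\<close>

text \<open>The pair \<open>(ns, a)\<close> stands for the path \<open>path_of ns\<close> followed
  by \<open>a\<close>. To cross \<open>e\<close>, split \<open>a\<close> into a representative and
  an edge group element, let \<open>flip\<close> handle the representative, and slide the edge group
  element across \<open>e\<close>.\<close>

fun step :: "('g \<times> 'e) list \<times> 'g \<Rightarrow> ('v, 'e, 'g) letter \<Rightarrow> ('g \<times> 'e) list \<times> 'g" where
  "step (ns, a) (Elt w g) = (ns, a \<otimes>\<^bsub>vgrp G w\<^esub> g)"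
| "step (ns, a) (Arc e) =
     (let (ns', t) = flip ns (rep (opp G e) a) e
      in (ns', t \<otimes>\<^bsub>vgrp G (ghead G e)\<^esub> inc G e (res (opp G e) a)))"

fun state :: "'v \<Rightarrow> ('g \<times> 'e) list \<times> 'g \<Rightarrow> bool" where
  "state v (ns, a) \<longleftrightarrow> nform v ns \<and> a \<in> carrier (vgrp G v)"

abbreviation run :: "('g \<times> 'e) list \<times> 'g \<Rightarrow> ('v, 'e, 'g) letter list \<Rightarrow> ('g \<times> 'e) list \<times> 'g" where
  "run \<equiv> foldl step"

definition nf :: "('v, 'e, 'g) letter list \<Rightarrow> ('g \<times> 'e) list \<times> 'g" where
  "nf \<gamma> = run ([], \<one>\<^bsub>vgrp G q\<^esub>) \<gamma>"

lemma nf_append: "nf (\<alpha> @ \<beta>) = run (nf \<alpha>) \<beta>"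
  by (simp add: nf_def)

lemma step_Arc:
  assumes e: "e \<in> garcs G" and s: "s \<in> S (opp G e)" and h: "h \<in> carrier (egrp G e)"
    and f: "flip ns s e = (ns', t)"
  shows "step (ns, s \<otimes>\<^bsub>vgrp G (gtail G e)\<^esub> inc G (opp G e) h) (Arc e) =
    (ns', t \<otimes>\<^bsub>vgrp G (ghead G e)\<^esub> inc G e h)"
  using rep_res_eqI[of "opp G e" s h] e s h f by (simp add: egrp_opp)

text \<open>Brings every crossing to the shape required by \<open>step_Arc\<close>; \<open>h\<close>
  is the edge group element carried across.\<close>

lemma state_ArcE:
  assumes e: "e \<in> garcs G" and st: "state (gtail G e) st"
  obtains ns s h ns' t where "st = (ns, s \<otimes>\<^bsub>vgrp G (gtail G e)\<^esub> inc G (opp G e) h)"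
    "nform (gtail G e) ns" "s \<in> S (opp G e)" "h \<in> carrier (egrp G e)"
    "flip ns s e = (ns', t)" "nform (ghead G e) ns'" "t \<in> S e"
    "s \<in> carrier (vgrp G (gtail G e))" "t \<in> carrier (vgrp G (ghead G e))"
proof -
  obtain ns a where na: "st = (ns, a)" "nform (gtail G e) ns" "a \<in> carrier (vgrp G (gtail G e))"
    using st by (cases st) auto
  obtain ns' t where f: "flip ns (rep (opp G e) a) e = (ns', t)" by force
  note r = rep_res[of "opp G e" a]
  have s: "rep (opp G e) a \<in> S (opp G e)" using r na e by auto
  note ff = flip_flip[OF e na(2) s f]
  show thesis
    by (rule that[of ns "rep (opp G e) a" "res (opp G e) a" ns' t])
       (use r na e ff f transversalD(1)[OF e] in \<open>auto simp: egrp_opp\<close>)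
qed

lemma state_step_Arc:
  assumes e: "e \<in> garcs G" and st: "state (gtail G e) st"
  shows "state (ghead G e) (step st (Arc e))"
proof -
  interpret M: group "vgrp G (ghead G e)" using e group_vgrp by simp
  obtain ns s h ns' t where "st = (ns, s \<otimes>\<^bsub>vgrp G (gtail G e)\<^esub> inc G (opp G e) h)"
    "nform (gtail G e) ns" "s \<in> S (opp G e)" "h \<in> carrier (egrp G e)"
    "flip ns s e = (ns', t)" "nform (ghead G e) ns'" "t \<in> S e" "t \<in> carrier (vgrp G (ghead G e))"
    using state_ArcE[OF e st] by metis
  then show ?thesis using e by (auto simp: step_Arc inc_closed simp del: step.simps)
qed

lemma state_run: "gpath G u \<gamma> v \<Longrightarrow> state u st \<Longrightarrow> state v (run st \<gamma>)"
proof (induction \<gamma> arbitrary: u st)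
  case (Cons x \<gamma>)
  show ?case
  proof (cases x)
    case (Elt w g)
    have "group (vgrp G u)" using Cons.prems gpath_verts group_vgrp by blast
    then have "state u (step st x)"
      using Cons.prems Elt by (cases st) (auto intro: monoid.m_closed group.is_monoid)
    then show ?thesis using Cons.IH[of u "step st x"] Cons.prems Elt by auto
  next
    case (Arc e)
    then show ?thesis
      using Cons.IH[of "ghead G e" "step st x"] Cons.prems state_step_Arc[of e st] by simp
  qed
qed auto

text \<open>Crossing \<open>e\<close> keeps the edge group element \<open>h\<close> and applies
  \<open>flip\<close>; crossing back keeps \<open>h\<close> again, so the claim reduces to
  \<open>flip_flip\<close>.\<close>

lemma step_back:
  assumes e: "e \<in> garcs G" and st: "state (gtail G e) st"
  shows "step (step st (Arc e)) (Arc (opp G e)) = st"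
proof -
  obtain ns s h ns' t where *: "st = (ns, s \<otimes>\<^bsub>vgrp G (gtail G e)\<^esub> inc G (opp G e) h)"
    "nform (gtail G e) ns" "s \<in> S (opp G e)" "h \<in> carrier (egrp G e)"
    "flip ns s e = (ns', t)" "nform (ghead G e) ns'" "t \<in> S e"
    using state_ArcE[OF e st] by metis
  then show ?thesis
    using e step_Arc[OF e *(3,4,5)] step_Arc[of "opp G e" t h ns' ns s] flip_flip[OF e *(2,3,5)]
    by (auto simp: egrp_opp simp del: step.simps)
qed

text \<open>Multiplication by an element of the edge group changes only the factor \<open>h\<close>,
  on which \<open>flip\<close> does not depend; the change reappears behind the arc.\<close>

lemma step_slide:
  assumes e: "e \<in> garcs G" and st: "state (gtail G e) st" and k: "k \<in> carrier (egrp G e)"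
  shows "step (step st (Elt (gtail G e) (inc G (opp G e) k))) (Arc e) =
    step (step st (Arc e)) (Elt (ghead G e) (inc G e k))"
proof -
  interpret M: group "vgrp G (ghead G e)" using e group_vgrp by simp
  interpret N: group "vgrp G (gtail G e)" using e group_vgrp by simp
  interpret E: group "egrp G e" using e group_egrp by simp
  obtain ns s h ns' t where *: "st = (ns, s \<otimes>\<^bsub>vgrp G (gtail G e)\<^esub> inc G (opp G e) h)"
    "nform (gtail G e) ns" "s \<in> S (opp G e)" "h \<in> carrier (egrp G e)"
    "flip ns s e = (ns', t)" "nform (ghead G e) ns'" "t \<in> S e"
    "s \<in> carrier (vgrp G (gtail G e))" "t \<in> carrier (vgrp G (ghead G e))"
    using state_ArcE[OF e st] by metis
  have "step st (Elt (gtail G e) (inc G (opp G e) k)) =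
      (ns, s \<otimes>\<^bsub>vgrp G (gtail G e)\<^esub> inc G (opp G e) (h \<otimes>\<^bsub>egrp G e\<^esub> k))"
    using * e k inc_mult[of "opp G e" h k] by (simp add: egrp_opp inc_opp_closed N.m_assoc)
  moreover have "h \<otimes>\<^bsub>egrp G e\<^esub> k \<in> carrier (egrp G e)" using * k by simp
  ultimately show ?thesis
    using step_Arc[OF e *(3) _ *(5)] * e k
    by (simp add: inc_mult inc_closed M.m_assoc del: step.simps(2))
qed

lemma run_rev: "gpath G u \<sigma> v \<Longrightarrow> state u st \<Longrightarrow> run (run st \<sigma>) (path_rev G \<sigma>) = st"
proof (induction \<sigma> arbitrary: u st)
  case (Cons x \<sigma>)
  show ?case
  proof (cases x)
    case (Elt w g)
    interpret M: group "vgrp G u" using Cons.prems gpath_verts group_vgrp by blast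
    have 1: "state u (step st x)" "step (step st x) (letter_rev G x) = st" "gpath G u \<sigma> v"
      using Cons.prems Elt by (cases st; auto simp: M.m_assoc)+
    then show ?thesis using Cons.IH[OF 1(3,1)] by simp
  next
    case (Arc e)
    then have 1: "state (ghead G e) (step st x)" "step (step st x) (letter_rev G x) = st"
      "gpath G (ghead G e) \<sigma> v"
      using Cons.prems by (auto simp: state_step_Arc step_back simp del: step.simps)
    then show ?thesis using Cons.IH[OF 1(3,1)] by simp
  qed
qed auto

text \<open>It suffices to test each generating move on the state reached after its prefix. Group
  laws handle products and identities, \<open>run_rev\<close> handles backtracks, and
  \<open>step_slide\<close> the edge relation.\<close>

lemma run_homotopic: "homotopic G u v \<gamma> \<gamma>' \<Longrightarrow> state u st \<Longrightarrow> run st \<gamma> = run st \<gamma>'"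
proof (induction rule: homotopic.induct)
  case (mult \<alpha> w g g' \<beta>)
  then have 1: "gpath G u \<alpha> w" "g \<in> carrier (vgrp G w)" "g' \<in> carrier (vgrp G w)" "w \<in> gverts G"
    using gpath_verts by (auto simp: gpath_append)
  then have "state w (run st \<alpha>)" using mult state_run by auto
  then show ?case
    using 1 group_vgrp[of w] by (cases "run st \<alpha>") (auto simp: monoid.m_assoc group.is_monoid)
next
  case (one \<alpha> w \<beta>)
  then have 1: "gpath G u \<alpha> w" "w \<in> gverts G"
    using gpath_verts by (auto simp: gpath_append)
  then have "state w (run st \<alpha>)" using one state_run by auto
  then show ?case
    using 1 group_vgrp[of w] by (cases "run st \<alpha>") (auto simp: monoid.r_one group.is_monoid)
next
  case (backtrack \<alpha> \<sigma> \<beta>)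
  then obtain w z where "gpath G u \<alpha> w" "gpath G w \<sigma> z"
    by (auto simp: gpath_append)
  then show ?case using backtrack.prems run_rev state_run by simp
next
  case (slide \<alpha> e h \<beta>)
  then have 1: "gpath G u \<alpha> (gtail G e)" "e \<in> garcs G"
    by (auto simp: gpath_append)
  then have "state (gtail G e) (run st \<alpha>)" using slide state_run by auto
  then show ?case using step_slide[of e "run st \<alpha>" h] 1 slide by (simp del: step.simps)
qed auto

lemma state_nf: "gpath G q \<gamma> v \<Longrightarrow> state v (nf \<gamma>)"
  unfolding nf_def using base_vertex group_vgrp[of q]
  by (intro state_run[of q]) (auto intro: monoid.one_closed group.is_monoid)

lemma nf_homotopic: "homotopic G q v \<gamma> \<gamma>' \<Longrightarrow> nf \<gamma> = nf \<gamma>'"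
  unfolding nf_def using base_vertex group_vgrp[of q]
  by (intro run_homotopic) (auto intro: monoid.one_closed group.is_monoid)

section \<open>Normal forms classify homotopy classes\<close>

definition path_of :: "('g \<times> 'e) list \<Rightarrow> ('v, 'e, 'g) letter list" where
  "path_of ns = concat (map (\<lambda>(s, e). [Elt (gtail G e) s, Arc e]) ns)"

lemma path_of_simps [simp]:
  "path_of [] = []" "path_of (ns @ [(s, e)]) = path_of ns @ [Elt (gtail G e) s, Arc e]"
  by (auto simp: path_of_def)

lemma gpath_path_of: "nform v ns \<Longrightarrow> gpath G q (path_of ns) v"
proof (induction ns arbitrary: v rule: rev_induct)
  case Nil
  then show ?case using base_vertex by simp
next
  case (snoc x ns)
  obtain s e where x: "x = (s, e)" by force
  with snoc show ?case
    using transversalD(1)[of "opp G e"] by (auto simp: nform_snoc intro!: gpath_appendI)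
qed

text \<open>In a reduced word no arc cancels its predecessor, so each crossing is a push and leaves
  \<open>1\<close>.\<close>

lemma nf_path_of: "nform v ns \<Longrightarrow> nf (path_of ns) = (ns, \<one>\<^bsub>vgrp G v\<^esub>)"
proof (induction ns arbitrary: v rule: rev_induct)
  case Nil
  then show ?case by (simp add: nf_def)
next
  case (snoc x ns)
  obtain s e where x: "x = (s, e)" by force
  with snoc.prems have e: "e \<in> garcs G" "nform (gtail G e) ns" "ghead G e = v" "s \<in> S (opp G e)"
    "flip ns s e = (ns @ [(s, e)], \<one>\<^bsub>vgrp G v\<^esub>)"
    by (auto simp: nform_snoc flip_def)
  interpret M: group "vgrp G (gtail G e)" using e group_vgrp by simp
  interpret N: group "vgrp G v" using e group_vgrp by auto
  have s: "s \<in> carrier (vgrp G (gtail G e))" using e transversalD(1)[of "opp G e"] by auto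
  show ?case
    using snoc.IH[OF e(2)] e s x rep_res_transversal[of "opp G e" s] inc_one[of e]
    by (simp add: nf_append egrp_opp)
qed

text \<open>Each step of the action is realized by generating moves, by induction on the last
  letter. With \<open>nf_homotopic\<close> this yields the normal form theorem
  \<open>homotopic_iff\<close>.\<close>

lemma homotopic_path_of_nf:
  "gpath G q \<gamma> v \<Longrightarrow> homotopic G q v \<gamma> (path_of (fst (nf \<gamma>)) @ [Elt v (snd (nf \<gamma>))])"
proof (induction \<gamma> arbitrary: v rule: rev_induct)
  case Nil
  then have q: "v = q" by simp
  have "gpath G q ([] @ [Elt q \<one>\<^bsub>vgrp G q\<^esub>] @ []) q"
    using base_vertex group_vgrp[of q] by (auto intro: monoid.one_closed group.is_monoid)
  from homotopic.one[OF this] show ?case using q by (auto simp: nf_def intro: homotopic.sym)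
next
  case (snoc x \<gamma>)
  obtain ns a where na: "nf \<gamma> = (ns, a)" by force
  show ?case
  proof (cases x)
    case (Elt w g)
    with snoc.prems have g: "gpath G q \<gamma> v" "w = v" "g \<in> carrier (vgrp G v)" "v \<in> gverts G"
      by (auto simp: gpath_append)
    have "homotopic G q v ([] @ \<gamma> @ [Elt v g]) ([] @ (path_of ns @ [Elt v a]) @ [Elt v g])"
      using snoc.IH[OF g(1)] na g base_vertex by (intro homotopic_append) auto
    also have "\<dots> = path_of ns @ [Elt v a, Elt v g] @ []" by simp
    finally have 1: "homotopic G q v (\<gamma> @ [Elt v g]) (path_of ns @ [Elt v a, Elt v g] @ [])" by simp
    note 2 = homotopic.mult[OF homotopic_gpath[OF 1, THEN conjunct2]]
    show ?thesis using homotopic.trans[OF 1 2] Elt g na by (simp add: nf_append)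
  next
    case (Arc e)
    with snoc.prems have g: "gpath G q \<gamma> (gtail G e)" "ghead G e = v" "e \<in> garcs G" "v \<in> gverts G"
      by (auto simp: gpath_append)
    let ?u = "gtail G e"
    interpret M: group "vgrp G (ghead G e)" using g group_vgrp by simp
    obtain s h ns' t where *: "a = s \<otimes>\<^bsub>vgrp G ?u\<^esub> inc G (opp G e) h"
      "nform ?u ns" "s \<in> S (opp G e)" "h \<in> carrier (egrp G e)"
      "flip ns s e = (ns', t)" "nform v ns'" "t \<in> S e" "s \<in> carrier (vgrp G ?u)" "t \<in> carrier (vgrp G v)"
      using state_ArcE[OF g(3) state_nf[OF g(1), unfolded na]] g(2) by (metis prod.inject)
    have nfa: "nf (\<gamma> @ [x]) = (ns', t \<otimes>\<^bsub>vgrp G v\<^esub> inc G e h)"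
      using step_Arc[OF g(3) *(3,4,5)] *(1) Arc na g by (simp add: nf_append del: step.simps)
    have inc: "inc G (opp G e) h \<in> carrier (vgrp G ?u)" "inc G e h \<in> carrier (vgrp G v)"
      using inc_opp_closed inc_closed * g by auto
    have p: "gpath G q (path_of ns) ?u" using gpath_path_of * by blast
    have "homotopic G q v ([] @ \<gamma> @ [Arc e]) ([] @ (path_of ns @ [Elt ?u a]) @ [Arc e])"
      using snoc.IH[OF g(1)] na g base_vertex by (intro homotopic_append) auto
    then have 1: "homotopic G q v (\<gamma> @ [Arc e]) (path_of ns @ [Elt ?u a, Arc e])" by simp
    \<comment> \<open>Split \<open>a\<close> into \<open>s\<close> and its edge group part, then
      slide the latter across \<open>e\<close>.\<close>
    have p2: "gpath G q (path_of ns @ [Elt ?u s, Elt ?u (inc G (opp G e) h)] @ [Arc e]) v"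
      using p g inc * by (auto intro!: gpath_appendI)
    have 2: "homotopic G q v (path_of ns @ [Elt ?u a, Arc e])
        (path_of ns @ [Elt ?u s, Elt ?u (inc G (opp G e) h)] @ [Arc e])"
      using homotopic.sym[OF homotopic.mult[OF p2]] *(1) by simp
    have p3: "gpath G q ((path_of ns @ [Elt ?u s]) @ [Arc e, Elt (ghead G e) (inc G e h)] @ []) v"
      using p g inc * by (auto intro!: gpath_appendI)
    have 3: "homotopic G q v (path_of ns @ [Elt ?u s, Elt ?u (inc G (opp G e) h)] @ [Arc e])
        (path_of ns @ [Elt ?u s, Arc e, Elt v (inc G e h)])"
      using homotopic.sym[OF homotopic.slide[OF p3 *(4)]] g by simp
    have 123: "homotopic G q v (\<gamma> @ [Arc e]) (path_of ns @ [Elt ?u s, Arc e, Elt v (inc G e h)])"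
      using homotopic.trans[OF homotopic.trans[OF 1 2] 3] .
    from g(3) *(2,3) show ?thesis
    proof (cases rule: flip_cases)
      \<comment> \<open>Here \<open>s\<close> is \<open>1\<close> and the word ends with
        \<open>opp G e\<close>: remove the identity, cancel the backtrack, and multiply
        \<open>t\<close> by the remaining edge group element.\<close>
      case (pop ns'' s')
      then have [simp]: "ns'' = ns'" "s' = t" using * by auto
      have p': "gpath G q (path_of ns') v" using gpath_path_of * by blast
      have "gpath G q ((path_of ns' @ [Elt v t, Arc (opp G e)]) @ [Elt ?u \<one>\<^bsub>vgrp G ?u\<^esub>] @
          [Arc e, Elt v (inc G e h)]) v"
        using p' g inc * pop(2) by (auto intro!: gpath_appendI)
      from homotopic.one[OF this]
      have 4: "homotopic G q v (path_of ns @ [Elt ?u s, Arc e, Elt v (inc G e h)])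
          (path_of ns' @ [Elt v t, Arc (opp G e), Arc e, Elt v (inc G e h)])"
        using g pop(1,2) by simp
      have "gpath G q ((path_of ns' @ [Elt v t]) @ [Arc (opp G e)] @ path_rev G [Arc (opp G e)] @
          [Elt v (inc G e h)]) v"
        using p' g inc * pop(2) by (auto intro!: gpath_appendI)
      from homotopic.backtrack[OF this]
      have 5: "homotopic G q v (path_of ns' @ [Elt v t, Arc (opp G e), Arc e, Elt v (inc G e h)])
          (path_of ns' @ [Elt v t, Elt v (inc G e h)] @ [])"
        using g by simp
      note 6 = homotopic.mult[OF homotopic_gpath[OF 5, THEN conjunct2]]
      show ?thesis
        using homotopic.trans[OF 123 homotopic.trans[OF 4 homotopic.trans[OF 5 6]]] nfa Arc by simp
    next
      case push
      then have "ns' = ns @ [(s, e)]" "t = \<one>\<^bsub>vgrp G v\<^esub>" using * g(2) by auto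
      then show ?thesis using 123 nfa Arc inc g(2) M.l_one[unfolded g(2)] by simp
    qed
  qed
qed

lemma homotopic_iff:
  "homotopic G q v \<gamma> \<gamma>' \<longleftrightarrow> gpath G q \<gamma> v \<and> gpath G q \<gamma>' v \<and> nf \<gamma> = nf \<gamma>'"
  using homotopic_gpath nf_homotopic homotopic_path_of_nf
  by (metis homotopic.sym homotopic.trans)

end

section \<open>The Bass--Serre tree in terms of normal forms\<close>

context gog_cover
begin

text \<open>Right multiplication by the vertex group moves the final element of a normal form
  arbitrarily and fixes the word, so a class consists of all paths with a given word.\<close>

lemma bs_vertex_eq:
  assumes \<gamma>: "gpath G q \<gamma> v"
  shows "bs_vertex G q v \<gamma> = (v, {\<gamma>'. gpath G q \<gamma>' v \<and> fst (nf \<gamma>') = fst (nf \<gamma>)})"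
proof -
  have v: "v \<in> gverts G" using gpath_verts[OF \<gamma>] by simp
  interpret M: group "vgrp G v" using v group_vgrp by simp
  obtain ns a where na: "nf \<gamma> = (ns, a)" "a \<in> carrier (vgrp G v)" using state_nf[OF \<gamma>] by (cases "nf \<gamma>") auto
  have "(\<exists>g\<in>carrier (vgrp G v). homotopic G q v \<gamma>' (\<gamma> @ [Elt v g])) \<longleftrightarrow>
      gpath G q \<gamma>' v \<and> fst (nf \<gamma>') = fst (nf \<gamma>)" for \<gamma>'
  proof
    assume "gpath G q \<gamma>' v \<and> fst (nf \<gamma>') = fst (nf \<gamma>)"
    moreover from this obtain a' where a': "nf \<gamma>' = (ns, a')" "a' \<in> carrier (vgrp G v)"
      using state_nf[of \<gamma>' v] na by (cases "nf \<gamma>'") auto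
    ultimately show "\<exists>g\<in>carrier (vgrp G v). homotopic G q v \<gamma>' (\<gamma> @ [Elt v g])"
      using \<gamma> na v
      by (intro bexI[of _ "inv\<^bsub>vgrp G v\<^esub> a \<otimes>\<^bsub>vgrp G v\<^esub> a'"])
         (auto simp: homotopic_iff nf_append M.m_assoc[symmetric] intro!: gpath_appendI)
  qed (use na in \<open>auto simp: homotopic_iff nf_append\<close>)
  then show ?thesis by (simp add: bs_vertex_def)
qed

text \<open>Multiplication by the edge group keeps the coset of the final element, and
  \<open>rep_eqE\<close> gives the converse. The class of an arc thus remembers the word and one
  coset representative.\<close>

lemma bs_arc_eq:
  assumes e: "e \<in> garcs G" and \<gamma>: "gpath G q \<gamma> (gtail G e)"
  shows "bs_arc G q e \<gamma> = (e, {\<gamma>'. gpath G q \<gamma>' (gtail G e) \<and> fst (nf \<gamma>') = fst (nf \<gamma>) \<and>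
    rep (opp G e) (snd (nf \<gamma>')) = rep (opp G e) (snd (nf \<gamma>))})"
proof -
  let ?v = "gtail G e"
  interpret M: group "vgrp G ?v" using e group_vgrp by simp
  obtain ns a where na: "nf \<gamma> = (ns, a)" "a \<in> carrier (vgrp G ?v)" using state_nf[OF \<gamma>] by (cases "nf \<gamma>") auto
  have "(\<exists>h\<in>carrier (egrp G e). homotopic G q ?v \<gamma>' (\<gamma> @ [Elt ?v (inc G (opp G e) h)])) \<longleftrightarrow>
      gpath G q \<gamma>' ?v \<and> fst (nf \<gamma>') = fst (nf \<gamma>) \<and>
      rep (opp G e) (snd (nf \<gamma>')) = rep (opp G e) (snd (nf \<gamma>))" for \<gamma>'
  proof
    assume *: "gpath G q \<gamma>' ?v \<and> fst (nf \<gamma>') = fst (nf \<gamma>) \<and>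
      rep (opp G e) (snd (nf \<gamma>')) = rep (opp G e) (snd (nf \<gamma>))"
    then obtain a' where a': "nf \<gamma>' = (ns, a')" "a' \<in> carrier (vgrp G ?v)"
      using state_nf[of \<gamma>' ?v] na by (cases "nf \<gamma>'") auto
    obtain h where "h \<in> carrier (egrp G e)" "a' = a \<otimes>\<^bsub>vgrp G ?v\<^esub> inc G (opp G e) h"
      using rep_eqE[of "opp G e" a a'] e na a' * by (auto simp: egrp_opp)
    then show "\<exists>h\<in>carrier (egrp G e). homotopic G q ?v \<gamma>' (\<gamma> @ [Elt ?v (inc G (opp G e) h)])"
      using \<gamma> na e * a'
      by (intro bexI[of _ h]) (auto simp: homotopic_iff nf_append inc_opp_closed intro!: gpath_appendI)
  next
    assume "\<exists>h\<in>carrier (egrp G e). homotopic G q ?v \<gamma>' (\<gamma> @ [Elt ?v (inc G (opp G e) h)])"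
    then show "gpath G q \<gamma>' ?v \<and> fst (nf \<gamma>') = fst (nf \<gamma>) \<and>
        rep (opp G e) (snd (nf \<gamma>')) = rep (opp G e) (snd (nf \<gamma>))"
      using na e rep_res_mult_inc(1)[of "opp G e" a] by (auto simp: homotopic_iff nf_append egrp_opp)
  qed
  then show ?thesis by (simp add: bs_arc_def)
qed

text \<open>With \<open>tarc\<close>, coordinates on the tree: words for the vertices over
  \<open>v\<close>, words followed by a coset representative for the arcs over \<open>e\<close>.
  They are faithful on normal forms by \<open>tvert_eq_iff\<close> and
  \<open>tarc_eq_iff\<close>.\<close>

definition tvert :: "'v \<Rightarrow> ('g \<times> 'e) list \<Rightarrow> ('v, 'e, 'g) bs_v" where
  "tvert v ns = bs_vertex G q v (path_of ns)"

definition tarc :: "'e \<Rightarrow> ('g \<times> 'e) list \<Rightarrow> 'g \<Rightarrow> ('v, 'e, 'g) bs_e" where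
  "tarc e ns s = bs_arc G q e (path_of ns @ [Elt (gtail G e) s])"

lemma fst_tvert [simp]: "fst (tvert v ns) = v"
  and fst_tarc [simp]: "fst (tarc e ns s) = e"
  by (auto simp: tvert_def tarc_def bs_vertex_def bs_arc_def)

lemma gpath_path_of_snoc:
  assumes "e \<in> garcs G" "nform (gtail G e) ns" "s \<in> S (opp G e)"
  shows "gpath G q (path_of ns @ [Elt (gtail G e) s]) (gtail G e)"
    and "nf (path_of ns @ [Elt (gtail G e) s]) = (ns, s)"
proof -
  interpret M: group "vgrp G (gtail G e)" using assms group_vgrp by simp
  have "s \<in> carrier (vgrp G (gtail G e))" using assms transversalD(1)[of "opp G e"] by auto
  then show "gpath G q (path_of ns @ [Elt (gtail G e) s]) (gtail G e)"
    and "nf (path_of ns @ [Elt (gtail G e) s]) = (ns, s)"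
    using assms gpath_path_of by (auto simp: nf_append nf_path_of intro!: gpath_appendI)
qed

lemma nform_nf: "gpath G q \<gamma> v \<Longrightarrow> nform v (fst (nf \<gamma>))"
  and nf_closed: "gpath G q \<gamma> v \<Longrightarrow> snd (nf \<gamma>) \<in> carrier (vgrp G v)"
  using state_nf by (metis prod.collapse state.simps)+

lemma bs_vertex_tvert: "gpath G q \<gamma> v \<Longrightarrow> bs_vertex G q v \<gamma> = tvert v (fst (nf \<gamma>))"
  using gpath_path_of[OF nform_nf] nf_path_of[OF nform_nf] by (simp add: tvert_def bs_vertex_eq)

lemma bs_arc_tarc:
  assumes e: "e \<in> garcs G" and \<gamma>: "gpath G q \<gamma> (gtail G e)"
  shows "bs_arc G q e \<gamma> = tarc e (fst (nf \<gamma>)) (rep (opp G e) (snd (nf \<gamma>)))"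
proof -
  have s: "rep (opp G e) (snd (nf \<gamma>)) \<in> S (opp G e)"
    using rep_res(1)[of "opp G e"] nf_closed[OF \<gamma>] e by simp
  show ?thesis
    using gpath_path_of_snoc[OF e nform_nf[OF \<gamma>] s] rep_res_transversal(1)[of "opp G e", OF _ s] e \<gamma>
    by (simp add: tarc_def bs_arc_eq)
qed

lemma tvert_eq_iff:
  assumes "nform v ns" "nform v' ns'"
  shows "tvert v ns = tvert v' ns' \<longleftrightarrow> v = v' \<and> ns = ns'"
proof
  assume eq: "tvert v ns = tvert v' ns'"
  then have v: "v = v'" by (metis fst_tvert)
  have "path_of ns \<in> snd (tvert v ns)"
    using assms(1) gpath_path_of by (auto simp: tvert_def bs_vertex_eq)
  then show "v = v' \<and> ns = ns'"
    using v assms gpath_path_of nf_path_of unfolding eq by (auto simp: tvert_def bs_vertex_eq)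
qed auto

lemma tarc_eq_iff:
  assumes "e \<in> garcs G" "nform (gtail G e) ns" "s \<in> S (opp G e)"
    and "e' \<in> garcs G" "nform (gtail G e') ns'" "s' \<in> S (opp G e')"
  shows "tarc e ns s = tarc e' ns' s' \<longleftrightarrow> e = e' \<and> ns = ns' \<and> s = s'"
proof
  assume eq: "tarc e ns s = tarc e' ns' s'"
  then have e: "e = e'" by (metis fst_tarc)
  note g = gpath_path_of_snoc[OF assms(1-3)] and g' = gpath_path_of_snoc[OF assms(4-6)]
  have "path_of ns @ [Elt (gtail G e) s] \<in> snd (tarc e ns s)"
    using g assms by (auto simp: tarc_def bs_arc_eq)
  then show "e = e' \<and> ns = ns' \<and> s = s'"
    using g g' assms rep_res_transversal(1)[of "opp G e"] e
    unfolding eq by (auto simp: tarc_def bs_arc_eq)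
qed auto

abbreviation T :: "(('v, 'e, 'g) bs_v, ('v, 'e, 'g) bs_e, unit) gog" where
  "T \<equiv> bs_tree G q"

lemma verts_T: "gverts T = {tvert v ns |v ns. nform v ns}"
proof -
  have "gverts T = {bs_vertex G q v \<gamma> |v \<gamma>. gpath G q \<gamma> v}" by (simp add: bs_tree_def Let_def)
  also have "\<dots> = {tvert v ns |v ns. nform v ns}"
  proof (intro subset_antisym subsetI)
    fix x assume "x \<in> {bs_vertex G q v \<gamma> |v \<gamma>. gpath G q \<gamma> v}"
    then show "x \<in> {tvert v ns |v ns. nform v ns}" using bs_vertex_tvert nform_nf by blast
  next
    fix x assume "x \<in> {tvert v ns |v ns. nform v ns}"
    then show "x \<in> {bs_vertex G q v \<gamma> |v \<gamma>. gpath G q \<gamma> v}"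
      using gpath_path_of unfolding tvert_def by blast
  qed
  finally show ?thesis .
qed

lemma arcs_T: "garcs T = {tarc e ns s |e ns s. e \<in> garcs G \<and> nform (gtail G e) ns \<and> s \<in> S (opp G e)}"
proof -
  have "garcs T = {bs_arc G q e \<gamma> |e \<gamma>. e \<in> garcs G \<and> gpath G q \<gamma> (gtail G e)}"
    by (simp add: bs_tree_def Let_def)
  also have "\<dots> = {tarc e ns s |e ns s. e \<in> garcs G \<and> nform (gtail G e) ns \<and> s \<in> S (opp G e)}"
  proof (intro subset_antisym subsetI)
    fix y assume "y \<in> {bs_arc G q e \<gamma> |e \<gamma>. e \<in> garcs G \<and> gpath G q \<gamma> (gtail G e)}"
    then obtain e \<gamma> where "y = bs_arc G q e \<gamma>" and e: "e \<in> garcs G" "gpath G q \<gamma> (gtail G e)" by blast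
    then have "y = tarc e (fst (nf \<gamma>)) (rep (opp G e) (snd (nf \<gamma>)))" by (simp add: bs_arc_tarc)
    then show "y \<in> {tarc e ns s |e ns s. e \<in> garcs G \<and> nform (gtail G e) ns \<and> s \<in> S (opp G e)}"
      using e nform_nf[OF e(2)] rep_res(1)[of "opp G e"] nf_closed[OF e(2)] by auto
  next
    fix y assume "y \<in> {tarc e ns s |e ns s. e \<in> garcs G \<and> nform (gtail G e) ns \<and> s \<in> S (opp G e)}"
    then show "y \<in> {bs_arc G q e \<gamma> |e \<gamma>. e \<in> garcs G \<and> gpath G q \<gamma> (gtail G e)}"
      using gpath_path_of_snoc(1) unfolding tarc_def by blast
  qed
  finally show ?thesis .
qed

text \<open>The tree uses an arbitrary path of a class. Its normal form is \<open>ns\<close> with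
  some element of the coset of \<open>s\<close>, and the unknown edge group factor affects neither
  the vertex reached by crossing \<open>e\<close> nor the reversed arc.\<close>

lemma
  assumes e: "e \<in> garcs G" and ns: "nform (gtail G e) ns" and s: "s \<in> S (opp G e)"
  shows tarc_in_T: "tarc e ns s \<in> garcs T"
    and tail_tarc: "gtail T (tarc e ns s) = tvert (gtail G e) ns"
    and head_tarc: "flip ns s e = (ns', t) \<Longrightarrow> ghead T (tarc e ns s) = tvert (ghead G e) ns'"
    and opp_tarc: "flip ns s e = (ns', t) \<Longrightarrow> opp T (tarc e ns s) = tarc (opp G e) ns' t"
proof -
  note g = gpath_path_of_snoc[OF e ns s]
  show in_T: "tarc e ns s \<in> garcs T" using assms unfolding arcs_T by blast
  obtain C where C: "tarc e ns s = (e, C)" by (metis fst_tarc prod.collapse)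
  define \<gamma> where "\<gamma> = (SOME \<gamma>. \<gamma> \<in> C)"
  have "C = {\<gamma>'. gpath G q \<gamma>' (gtail G e) \<and> fst (nf \<gamma>') = ns \<and> rep (opp G e) (snd (nf \<gamma>')) = s}"
    using C g e rep_res_transversal(1)[of "opp G e", OF _ s] by (simp add: tarc_def bs_arc_eq)
  moreover have "path_of ns @ [Elt (gtail G e) s] \<in> C"
    using g e rep_res_transversal(1)[of "opp G e", OF _ s] unfolding calculation by simp
  then have "\<gamma> \<in> C" unfolding \<gamma>_def by (rule someI)
  ultimately have \<gamma>: "gpath G q \<gamma> (gtail G e)" "fst (nf \<gamma>) = ns" "rep (opp G e) (snd (nf \<gamma>)) = s" by auto
  have "gtail T (tarc e ns s) = bs_vertex G q (gtail G e) \<gamma>"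
    unfolding C \<gamma>_def by (simp add: bs_tree_def Let_def)
  then show "gtail T (tarc e ns s) = tvert (gtail G e) ns" using \<gamma> by (simp add: bs_vertex_tvert)
  have p: "gpath G q (\<gamma> @ [Arc e]) (ghead G e)" using \<gamma> e by (auto intro!: gpath_appendI)
  assume f: "flip ns s e = (ns', t)"
  note ff = flip_flip[OF e ns s f]
  \<comment> \<open>The factor that depends on the choice of \<open>\<gamma>\<close>; it is carried
    across the arc as \<open>inc G e h\<close>.\<close>
  define h where "h = res (opp G e) (snd (nf \<gamma>))"
  have h: "h \<in> carrier (egrp G e)"
    using rep_res(3)[of "opp G e" "snd (nf \<gamma>)"] nf_closed[OF \<gamma>(1)] e by (simp add: h_def egrp_opp)
  have nf: "nf (\<gamma> @ [Arc e]) = (ns', t \<otimes>\<^bsub>vgrp G (ghead G e)\<^esub> inc G e h)"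
    using \<gamma> f by (cases "nf \<gamma>") (simp add: nf_append h_def)
  have "ghead T (tarc e ns s) = bs_vertex G q (ghead G e) (\<gamma> @ [Arc e])"
    unfolding C \<gamma>_def by (simp add: bs_tree_def Let_def)
  then show "ghead T (tarc e ns s) = tvert (ghead G e) ns'" using p nf by (simp add: bs_vertex_tvert)
  have "opp T (tarc e ns s) = bs_arc G q (opp G e) (\<gamma> @ [Arc e])"
    using in_T unfolding C \<gamma>_def by (simp add: bs_tree_def Let_def)
  then show "opp T (tarc e ns s) = tarc (opp G e) ns' t"
    using p nf e rep_res_eqI(1)[OF e ff(2) h] by (simp add: bs_arc_tarc)
qed

section \<open>Tight paths and the covering projection\<close>

lemma bs_base_tvert: "bs_base G q = tvert q []"
  by (simp add: bs_base_def tvert_def)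

lemma lift_arcs_snoc:
  "lift_arcs G q \<gamma> (ns @ [(s, e)]) =
     lift_arcs G q \<gamma> ns @ [bs_arc G q e (\<gamma> @ path_of ns @ [Elt (gtail G e) s])]"
  by (induction ns arbitrary: \<gamma>) (auto simp: path_of_def)

lemma lift_arcs_Nil_snoc:
  "lift_arcs G q [] (ns @ [(s, e)]) = lift_arcs G q [] ns @ [tarc e ns s]"
  by (simp add: lift_arcs_snoc tarc_def)

lemma lift_arcs_eq_Nil [simp]: "lift_arcs G q \<gamma> ns = [] \<longleftrightarrow> ns = []"
  by (cases ns) auto

lemma base_in_T: "tvert q [] \<in> gverts T"
  using base_vertex nform_Nil unfolding verts_T by blast

lemma tight_path_snoc:
  "tight_path T u (xs @ [y]) v \<longleftrightarrow> tight_path T u xs (gtail T y) \<and> y \<in> garcs T \<and> ghead T y = v \<and>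
     (xs \<noteq> [] \<longrightarrow> y \<noteq> opp T (last xs))"
  by (auto simp: tight_path_def pre_digraph.awalk_snoc_iff successively_snoc_iff)

text \<open>Reducedness of the word becomes tightness: the next arc can reverse the preceding one
  only if it has representative \<open>1\<close> and lies over the opposite arc.\<close>

lemma tight_path_lift_arcs: "nform v ns \<Longrightarrow> tight_path T (tvert q []) (lift_arcs G q [] ns) (tvert v ns)"
proof (induction ns arbitrary: v rule: rev_induct)
  case Nil
  then show ?case using base_in_T by (simp add: tight_path_def pre_digraph.awalk_def pre_digraph.cas.simps)
next
  case (snoc x ns)
  obtain s e where x: "x = (s, e)" by force
  with snoc.prems have e: "e \<in> garcs G" "nform (gtail G e) ns" "s \<in> S (opp G e)" "ghead G e = v"
    "flip ns s e = (ns @ [(s, e)], \<one>\<^bsub>vgrp G v\<^esub>)"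
    by (auto simp: nform_snoc flip_def)
  have "tarc e ns s \<noteq> opp T (last (lift_arcs G q [] ns))" if "lift_arcs G q [] ns \<noteq> []"
  proof -
    obtain ns' s' e' where ns': "ns = ns' @ [(s', e')]"
      using \<open>lift_arcs G q [] ns \<noteq> []\<close> by (metis lift_arcs_eq_Nil prod.collapse rev_exhaust)
    then have e': "e' \<in> garcs G" "nform (gtail G e') ns'" "s' \<in> S (opp G e')" "ghead G e' = gtail G e"
      "flip ns' s' e' = (ns, \<one>\<^bsub>vgrp G (ghead G e')\<^esub>)"
      using e by (auto simp: nform_snoc flip_def)
    \<comment> \<open>The preceding arc was created by a push, so its reverse carries the
      representative \<open>1\<close>.\<close>
    have "opp T (last (lift_arcs G q [] ns)) = tarc (opp G e') ns \<one>\<^bsub>vgrp G (ghead G e')\<^esub>"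
      using opp_tarc[OF e'(1-3,5)] ns' by (simp add: lift_arcs_Nil_snoc)
    moreover have "\<not> (e = opp G e' \<and> s = \<one>\<^bsub>vgrp G (ghead G e')\<^esub>)"
    proof
      assume *: "e = opp G e' \<and> s = \<one>\<^bsub>vgrp G (ghead G e')\<^esub>"
      then have "ns \<noteq> [] \<and> s = \<one>\<^bsub>vgrp G (gtail G e)\<^esub> \<and> snd (last ns) = opp G e"
        using ns' e'(4) by simp
      then show False using snoc.prems unfolding x nform_snoc by blast
    qed
    moreover have "opp G e' \<in> garcs G" "nform (gtail G (opp G e')) ns"
      "\<one>\<^bsub>vgrp G (ghead G e')\<^esub> \<in> S (opp G (opp G e'))"
      using flip_flip(1,2)[OF e'(1-3,5)] e'(1) by simp_all
    ultimately show ?thesis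
      using tarc_eq_iff[OF e(1-3), of "opp G e'" ns "\<one>\<^bsub>vgrp G (ghead G e')\<^esub>"] by metis
  qed
  then show ?case
    using snoc.IH[OF e(2)] e x
    by (simp add: lift_arcs_Nil_snoc tight_path_snoc tarc_in_T tail_tarc head_tarc[OF e(1-3,5)])
qed

lemma arcs_T_tail_E:
  assumes "y \<in> garcs T"
  obtains e ns s ns' t where "y = tarc e ns s" "e \<in> garcs G" "nform (gtail G e) ns" "s \<in> S (opp G e)"
    "flip ns s e = (ns', t)"
proof -
  obtain e ns s where "y = tarc e ns s" "e \<in> garcs G" "nform (gtail G e) ns" "s \<in> S (opp G e)"
    using assms unfolding arcs_T by blast
  then show thesis using that[of e ns s "fst (flip ns s e)" "snd (flip ns s e)"] by simp
qed

text \<open>An arc added to a lifted word either pushes, extending the word, or pops; in the latter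
  case it reverses the last arc, contrary to tightness. Together with
  \<open>tight_path_lift_arcs\<close>, tight paths from the base are exactly the lifts of normal
  forms.\<close>

lemma tight_pathD:
  "tight_path T (tvert q []) xs x \<Longrightarrow> \<exists>v ns. nform v ns \<and> x = tvert v ns \<and> xs = lift_arcs G q [] ns"
proof (induction xs arbitrary: x rule: rev_induct)
  case Nil
  then show ?case
    by (intro exI[of _ q] exI[of _ "[]"]) (auto simp: tight_path_def pre_digraph.awalk_def pre_digraph.cas.simps)
next
  case (snoc y xs)
  then have y: "y \<in> garcs T" "tight_path T (tvert q []) xs (gtail T y)" "ghead T y = x"
    "xs \<noteq> [] \<Longrightarrow> y \<noteq> opp T (last xs)"
    by (auto simp: tight_path_snoc)
  obtain e ns s ns' t where e: "y = tarc e ns s" "e \<in> garcs G" "nform (gtail G e) ns" "s \<in> S (opp G e)"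
    "flip ns s e = (ns', t)"
    using arcs_T_tail_E[OF y(1)] by metis
  obtain v n where "nform v n" "tvert (gtail G e) ns = tvert v n" "xs = lift_arcs G q [] n"
    using snoc.IH[OF y(2)] e by (auto simp: tail_tarc)
  with e have xs: "xs = lift_arcs G q [] ns" by (simp add: tvert_eq_iff)
  from e(2-4) show ?case
  proof (cases rule: flip_cases)
    case (pop ns'' s')
    then have "opp T (last xs) = tarc e ns s"
      using opp_tarc[of "opp G e" ns'' s' ns s] flip_flip[OF e(2-4) pop(3)] e xs
      by (simp add: lift_arcs_Nil_snoc)
    then show ?thesis using y(4) xs pop(1) e(1) by simp
  next
    case push
    then show ?thesis
      using head_tarc[OF e(2-4) push(2)] y(3) e(1) xs
      by (intro exI[of _ "ghead G e"] exI[of _ "ns @ [(s, e)]"]) (auto simp: lift_arcs_Nil_snoc)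
  qed
qed

lemma the_tight_path:
  assumes "nform v ns"
  shows "(THE xs. tight_path T (bs_base G q) xs (tvert v ns)) = lift_arcs G q [] ns"
  unfolding bs_base_tvert
proof (rule the_equality)
  fix xs assume "tight_path T (tvert q []) xs (tvert v ns)"
  then show "xs = lift_arcs G q [] ns" using tight_pathD assms by (metis tvert_eq_iff)
qed (rule tight_path_lift_arcs[OF assms])

text \<open>The end of the lifted path already determines the word.\<close>

lemma lift_arcs_inj:
  assumes "nform v ns" "nform v' ns'" "lift_arcs G q [] ns = lift_arcs G q [] ns'"
  shows "ns = ns'"
proof -
  have "tvert v ns = tvert v' ns'"
    using tight_path_lift_arcs[OF assms(1)] tight_path_lift_arcs[OF assms(2)] assms(3)
    by (auto simp: tight_path_def pre_digraph.awalk_def intro: pre_digraph.cas_unique)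
  then show ?thesis using assms by (simp add: tvert_eq_iff)
qed

lemma the_normal_form:
  assumes "nform v ns"
  shows "(THE ns'. normal_form G S q ns' \<and> lift_arcs G q [] ns' = lift_arcs G q [] ns) = ns"
  using assms lift_arcs_inj by (intro the_equality) (auto simp: normal_form_iff)

text \<open>The case distinction defining the covering projection matches that of \<^const>\<open>flip\<close>.\<close>

lemma cov_delta_tarc:
  assumes e: "e \<in> garcs G" and ns: "nform (gtail G e) ns" and s: "s \<in> S (opp G e)"
    and f: "flip ns s e = (ns', t)"
  shows "cov_delta G S q (tarc e ns s) = t"
proof -
  note ff = flip_flip[OF e ns s f]
  define y where "y = opp T (tarc e ns s)"
  have y: "y = tarc (opp G e) ns' t" using opp_tarc[OF e ns s f] by (simp add: y_def)
  have hy: "ghead T y = tvert (gtail G e) ns"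
    using head_tarc[of "opp G e" ns' t ns s] ff e y by simp
  have delta: "cov_delta G S q (tarc e ns s) =
     (if ns \<noteq> [] \<and> last (lift_arcs G q [] ns) = y then fst (last ns) else \<one>\<^bsub>vgrp G (ghead G e)\<^esub>)"
    unfolding cov_delta_def Let_def y_def[symmetric] hy the_tight_path[OF ns] the_normal_form[OF ns]
    by simp
  show ?thesis
    using e ns s
  proof (cases rule: flip_cases)
    case (pop ns'' s')
    then show ?thesis using f delta y by (simp add: lift_arcs_Nil_snoc)
  next
    case push
    have "last (lift_arcs G q [] ns) \<noteq> y" if "ns \<noteq> []"
    proof
      assume eq: "last (lift_arcs G q [] ns) = y"
      obtain n a d where n: "ns = n @ [(a, d)]" using \<open>ns \<noteq> []\<close> by (metis prod.collapse rev_exhaust)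
      then have "tarc d n a = tarc (opp G e) ns' t" using eq y by (simp add: lift_arcs_Nil_snoc)
      moreover have "d \<in> garcs G" "nform (gtail G d) n" "a \<in> S (opp G d)"
        using ns n by (auto simp: nform_snoc)
      \<comment> \<open>A contradiction: \<open>n\<close> is \<open>ns\<close> without its last
        entry, whereas \<open>ns'\<close> is \<open>ns\<close> with one more.\<close>
      ultimately have "n = ns'" using e ff by (simp add: tarc_eq_iff)
      then show False using push(2) f n by simp
    qed
    then show ?thesis using push(2) f delta by auto
  qed
qed

end

section \<open>Lifting a morphism\<close>

locale gog_mor = L: gog_data L + G: gog_data G
  for L :: "('v, 'e, 'g) gog" and G :: "('w, 'd, 'k) gog" +
  fixes f :: "('v, 'e, 'g, 'w, 'd, 'k) gog_mor"
  assumes morphism: "gog_morphism L G f"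
begin

lemma on_v_in: "v \<in> gverts L \<Longrightarrow> on_v f v \<in> gverts G"
  and hom_v_hom: "v \<in> gverts L \<Longrightarrow> hom_v f v \<in> hom (vgrp L v) (vgrp G (on_v f v))"
  using morphism by (auto simp: gog_morphism_def)

lemma hom_v_closed:
  "v \<in> gverts L \<Longrightarrow> g \<in> carrier (vgrp L v) \<Longrightarrow> hom_v f v g \<in> carrier (vgrp G (on_v f v))"
  using hom_v_hom by (blast intro: hom_in_carrier)

lemma hom_v_one: "v \<in> gverts L \<Longrightarrow> hom_v f v \<one>\<^bsub>vgrp L v\<^esub> = \<one>\<^bsub>vgrp G (on_v f v)\<^esub>"
  using hom_v_hom on_v_in L.group_vgrp G.group_vgrp by (intro hom_one) auto

lemma arc_morphism:
  assumes "e \<in> garcs L"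
  shows "cell_in G (on_e f e)" "cell_head G (on_e f e) = on_v f (ghead L e)"
    "on_e f (opp L e) = cell_opp G (on_e f e)"
    "hom_e f e \<in> hom (egrp L e) (cell_grp G (on_e f e))"
    "delta f e \<in> carrier (vgrp G (on_v f (ghead L e)))"
  using morphism assms unfolding gog_morphism_def Let_def by auto

lemma delta_opp_closed:
  "e \<in> garcs L \<Longrightarrow> delta f (opp L e) \<in> carrier (vgrp G (on_v f (gtail L e)))"
  using arc_morphism(5)[of "opp L e"] by simp

lemma on_e_InlD:
  assumes "e \<in> garcs L" "on_e f e = Inl w"
  shows "on_e f (opp L e) = Inl w" "on_v f (gtail L e) = w" "on_v f (ghead L e) = w"
  using arc_morphism[OF assms(1)] arc_morphism[of "opp L e"] assms by auto

lemma on_e_InrD: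
  assumes "e \<in> garcs L" "on_e f e = Inr d"
  shows "d \<in> garcs G" "on_e f (opp L e) = Inr (opp G d)"
    "on_v f (gtail L e) = gtail G d" "on_v f (ghead L e) = ghead G d"
  using arc_morphism[OF assms(1)] arc_morphism[of "opp L e"] assms by auto

lemma hom_e_one:
  assumes "e \<in> garcs L"
  shows "group (cell_grp G (on_e f e))" "hom_e f e \<one>\<^bsub>egrp L e\<^esub> = \<one>\<^bsub>cell_grp G (on_e f e)\<^esub>"
proof -
  show g: "group (cell_grp G (on_e f e))"
    using arc_morphism(1)[OF assms] G.group_vgrp G.group_egrp by (cases "on_e f e") auto
  show "hom_e f e \<one>\<^bsub>egrp L e\<^esub> = \<one>\<^bsub>cell_grp G (on_e f e)\<^esub>"
    using arc_morphism(4)[OF assms] L.group_egrp[OF assms] g by (intro hom_one)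
qed

end

locale gog_lift = L: gog_cover L S p + G: gog_cover G R "on_v f p" + gog_mor L G f
  for L :: "('v, 'e, 'g) gog" and S and p and G :: "('w, 'd, 'k) gog" and R
    and f :: "('v, 'e, 'g, 'w, 'd, 'k) gog_mor"
begin

section \<open>Images of normal forms under the morphism\<close>

text \<open>The action of \<open>f\<close> on paths, letter by letter; a collapsed arc leaves only
  its two group elements, both inserted at the image vertex \<open>w\<close>.\<close>

fun letter_image :: "('v, 'e, 'g) letter \<Rightarrow> ('w, 'd, 'k) letter list" where
  "letter_image (Elt v g) = [Elt (on_v f v) (hom_v f v g)]"
| "letter_image (Arc e) =
     Elt (on_v f (gtail L e)) (delta f (opp L e)) #
     (case on_e f e of Inl w \<Rightarrow> [] | Inr d \<Rightarrow> [Arc d]) @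
     [Elt (on_v f (ghead L e)) (inv\<^bsub>vgrp G (on_v f (ghead L e))\<^esub> delta f e)]"

definition path_image :: "('v, 'e, 'g) letter list \<Rightarrow> ('w, 'd, 'k) letter list" where
  "path_image \<gamma> = concat (map letter_image \<gamma>)"

lemma gpath_path_image: "gpath L u \<gamma> v \<Longrightarrow> gpath G (on_v f u) (path_image \<gamma>) (on_v f v)"
proof (induction \<gamma> arbitrary: u)
  case Nil
  then show ?case using on_v_in by (auto simp: path_image_def)
next
  case (Cons x \<gamma>)
  show ?case
  proof (cases x)
    case (Elt w g)
    then show ?thesis
      using Cons L.gpath_verts[OF Cons.prems] hom_v_closed by (auto simp: path_image_def)
  next
    case (Arc e)
    with Cons.prems have e: "e \<in> garcs L" "gtail L e = u" "gpath L (ghead L e) \<gamma> v" by auto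
    have "gpath G (on_v f (ghead L e)) (path_image \<gamma>) (on_v f v)" using Cons.IH e by simp
    moreover have "inv\<^bsub>vgrp G (on_v f (ghead L e))\<^esub> delta f e \<in> carrier (vgrp G (on_v f (ghead L e)))"
      using e arc_morphism(5)[OF e(1)] on_v_in G.group_vgrp by (intro group.inv_closed) auto
    ultimately show ?thesis
      using e Arc delta_opp_closed[OF e(1)] on_e_InlD[OF e(1)] on_e_InrD[OF e(1)]
      by (auto simp: path_image_def split: sum.splits)
  qed
qed

text \<open>\<open>fst (img ns)\<close> describes the image of a tree vertex and \<open>snd (img ns)\<close> the change of
  reference element there.\<close>

definition img :: "('g \<times> 'e) list \<Rightarrow> ('k \<times> 'd) list \<times> 'k" where
  "img ns = G.nf (path_image (L.path_of ns))"

text \<open>The final element reached in the image when that of \<open>e\<close> is about to be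
  crossed: after the images of the word and of \<open>s\<close>, and after the factor
  \<open>delta f (opp L e)\<close> with which the image of \<open>e\<close> begins. If
  \<open>e\<close> is not collapsed, its coset determines the image arc.\<close>

definition dev :: "'e \<Rightarrow> ('g \<times> 'e) list \<Rightarrow> 'g \<Rightarrow> 'k" where
  "dev e ns s = snd (img ns) \<otimes>\<^bsub>vgrp G (on_v f (gtail L e))\<^esub>
     (hom_v f (gtail L e) s \<otimes>\<^bsub>vgrp G (on_v f (gtail L e))\<^esub> delta f (opp L e))"

lemma img_Nil: "img [] = ([], \<one>\<^bsub>vgrp G (on_v f p)\<^esub>)"
  by (simp add: img_def path_image_def G.nf_def)

lemma nform_img: "L.nform v ns \<Longrightarrow> G.nform (on_v f v) (fst (img ns))"
  and img_closed: "L.nform v ns \<Longrightarrow> snd (img ns) \<in> carrier (vgrp G (on_v f v))"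
  unfolding img_def by (blast intro: G.nform_nf G.nf_closed gpath_path_image L.gpath_path_of)+

lemma
  assumes "e \<in> garcs L" "L.nform (gtail L e) ns" "s \<in> S (opp L e)"
  shows hom_v_rep_closed: "hom_v f (gtail L e) s \<in> carrier (vgrp G (on_v f (gtail L e)))"
    and dev_closed: "dev e ns s \<in> carrier (vgrp G (on_v f (gtail L e)))"
proof -
  interpret M: group "vgrp G (on_v f (gtail L e))" using assms on_v_in G.group_vgrp by simp
  show "hom_v f (gtail L e) s \<in> carrier (vgrp G (on_v f (gtail L e)))"
    using assms L.transversalD(1)[of "opp L e"] by (intro hom_v_closed) auto
  then show "dev e ns s \<in> carrier (vgrp G (on_v f (gtail L e)))"
    unfolding dev_def using img_closed assms delta_opp_closed by simp
qed

lemma state_dev: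
  assumes "e \<in> garcs L" "L.nform (gtail L e) ns" "s \<in> S (opp L e)"
  shows "G.state (on_v f (gtail L e)) (fst (img ns), dev e ns s)"
  using nform_img[OF assms(2)] dev_closed[OF assms] by simp

lemma img_push:
  assumes e: "e \<in> garcs L" and ns: "L.nform (gtail L e) ns" and s: "s \<in> S (opp L e)"
  shows "img (ns @ [(s, e)]) =
    G.run (fst (img ns), dev e ns s) ((case on_e f e of Inl w \<Rightarrow> [] | Inr d \<Rightarrow> [Arc d]) @
      [Elt (on_v f (ghead L e)) (inv\<^bsub>vgrp G (on_v f (ghead L e))\<^esub> delta f e)])"
proof -
  interpret M: group "vgrp G (on_v f (gtail L e))" using e on_v_in G.group_vgrp by simp
  have "img (ns @ [(s, e)]) = G.run (img ns) (path_image [Elt (gtail L e) s, Arc e])"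
    by (simp add: img_def path_image_def G.nf_append)
  moreover have "G.run (img ns) [Elt (on_v f (gtail L e)) (hom_v f (gtail L e) s),
      Elt (on_v f (gtail L e)) (delta f (opp L e))] = (fst (img ns), dev e ns s)"
    using img_closed[OF ns] hom_v_rep_closed[OF e ns s] delta_opp_closed[OF e]
    by (cases "img ns") (simp add: dev_def M.m_assoc)
  ultimately show ?thesis by (simp add: path_image_def)
qed

text \<open>The image of \<open>e\<close> ends with the inverse of \<open>delta f e\<close>, and
  that of the reversed arc begins with \<open>delta f e\<close>. These cancel, so only the crossing
  of the underlying image arc remains.\<close>

lemma dev_push:
  assumes e: "e \<in> garcs L" and ns: "L.nform (gtail L e) ns" and s: "s \<in> S (opp L e)"
    and ns': "L.nform (ghead L e) (ns @ [(s, e)])"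
  shows "(fst (img (ns @ [(s, e)])), dev (opp L e) (ns @ [(s, e)]) \<one>\<^bsub>vgrp L (ghead L e)\<^esub>) =
    G.run (fst (img ns), dev e ns s) (case on_e f e of Inl w \<Rightarrow> [] | Inr d \<Rightarrow> [Arc d])"
proof -
  let ?c = "case on_e f e of Inl w \<Rightarrow> [] | Inr d \<Rightarrow> [Arc d]"
  let ?M = "vgrp G (on_v f (ghead L e))"
  interpret M: group ?M using e on_v_in G.group_vgrp by simp
  obtain m b where mb: "G.run (fst (img ns), dev e ns s) ?c = (m, b)" by force
  have "gpath G (on_v f (gtail L e)) ?c (on_v f (ghead L e))"
    using e on_v_in on_e_InlD[OF e] on_e_InrD[OF e] by (auto split: sum.splits)
  then have b: "b \<in> carrier ?M"
    using G.state_run state_dev[OF e ns s] mb by fastforce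
  have img: "img (ns @ [(s, e)]) = (m, b \<otimes>\<^bsub>?M\<^esub> inv\<^bsub>?M\<^esub> delta f e)"
    using mb by (simp add: img_push[OF e ns s])
  have "dev (opp L e) (ns @ [(s, e)]) \<one>\<^bsub>vgrp L (ghead L e)\<^esub> = b"
    using e b arc_morphism(5)[OF e] by (simp add: dev_def img hom_v_one M.m_assoc)
  then show ?thesis using img mb by simp
qed

text \<open>The states at the two ends of a tree arc are exchanged by crossing its image. A push is
  \<open>dev_push\<close>; a pop is a push along the opposite arc, undone by
  \<open>G.step_back\<close>.\<close>

lemma dev_flip:
  assumes e: "e \<in> garcs L" and ns: "L.nform (gtail L e) ns" and s: "s \<in> S (opp L e)"
    and flip: "L.flip ns s e = (ns', t)"
  shows "(fst (img ns'), dev (opp L e) ns' t) =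
    G.run (fst (img ns), dev e ns s) (case on_e f e of Inl w \<Rightarrow> [] | Inr d \<Rightarrow> [Arc d])"
  using e ns s
proof (cases rule: L.flip_cases)
  case (pop n a)
  note ff = L.flip_flip[OF e ns s flip]
  have *: "ns = ns' @ [(t, opp L e)]" "s = \<one>\<^bsub>vgrp L (gtail L e)\<^esub>" using pop flip by auto
  have "(fst (img ns), dev e ns s) =
      G.run (fst (img ns'), dev (opp L e) ns' t) (case on_e f (opp L e) of Inl w \<Rightarrow> [] | Inr d \<Rightarrow> [Arc d])"
    using dev_push[of "opp L e" ns' t] e ns ff * by simp
  then show ?thesis
    using on_e_InlD[OF e] on_e_InrD[OF e] state_dev[of "opp L e" ns' t] ff e
      G.step_back[of "opp G d" "(fst (img ns'), dev (opp L e) ns' t)" for d]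
    by (auto simp del: G.step.simps split: sum.splits)
next
  case push
  then show ?thesis using dev_push[OF e ns s] flip by simp
qed

lemma dev_flip_Inl:
  assumes "e \<in> garcs L" "L.nform (gtail L e) ns" "s \<in> S (opp L e)" "L.flip ns s e = (ns', t)"
    and "on_e f e = Inl w"
  shows "fst (img ns') = fst (img ns)" "dev (opp L e) ns' t = dev e ns s"
  using dev_flip[OF assms(1-4)] assms(5) by auto

text \<open>Crossing the image arc acts by \<open>flip\<close> and carries the edge group factor
  unchanged. The first part makes the lift compatible with reversal, the second makes the edge
  elements \<open>l\<close> of the square symmetric.\<close>

lemma dev_flip_Inr:
  assumes e: "e \<in> garcs L" and ns: "L.nform (gtail L e) ns" and s: "s \<in> S (opp L e)"
    and flip: "L.flip ns s e = (ns', t)" and d: "on_e f e = Inr d"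
  shows "G.flip (fst (img ns)) (G.rep (opp G d) (dev e ns s)) d =
      (fst (img ns'), G.rep d (dev (opp L e) ns' t))"
    and "G.res (opp G d) (dev e ns s) = G.res d (dev (opp L e) ns' t)"
proof -
  note D = on_e_InrD[OF e d]
  let ?b = "dev e ns s"
  have b: "?b \<in> carrier (vgrp G (ghead G (opp G d)))" using dev_closed[OF e ns s] D by simp
  note r = G.rep_res[of "opp G d" ?b, OF _ b]
  obtain m u where m: "G.flip (fst (img ns)) (G.rep (opp G d) ?b) d = (m, u)" by force
  have ms: "G.nform (gtail G d) (fst (img ns))" using nform_img[OF ns] D by simp
  have rb: "G.rep (opp G d) ?b \<in> R (opp G d)" using r D by simp
  note ff = G.flip_flip[OF D(1) ms rb m]
  have h: "G.res (opp G d) ?b \<in> carrier (egrp G d)" using r D by (simp add: G.egrp_opp)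
  have "(fst (img ns'), dev (opp L e) ns' t) = (m, u \<otimes>\<^bsub>vgrp G (ghead G d)\<^esub> inc G d (G.res (opp G d) ?b))"
    using dev_flip[OF e ns s flip] d m by simp
  then show "G.flip (fst (img ns)) (G.rep (opp G d) ?b) d = (fst (img ns'), G.rep d (dev (opp L e) ns' t))"
    "G.res (opp G d) ?b = G.res d (dev (opp L e) ns' t)"
    using G.rep_res_eqI[OF D(1) ff(2) h] m by auto
qed

section \<open>The two composites of the square\<close>

lemma on_v_comp_cov [simp]: "on_v (mor_comp X G f (cov_proj L S p)) x = on_v f (fst x)"
  and on_e_comp_cov [simp]: "on_e (mor_comp X G f (cov_proj L S p)) y = on_e f (fst y)"
  and hom_v_comp_cov [simp]:
    "hom_v (mor_comp X G f (cov_proj L S p)) x g = hom_v f (fst x) \<one>\<^bsub>vgrp L (fst x)\<^esub>"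
  and hom_e_comp_cov [simp]:
    "hom_e (mor_comp X G f (cov_proj L S p)) y h = hom_e f (fst y) \<one>\<^bsub>egrp L (fst y)\<^esub>"
  and delta_comp_cov [simp]:
    "delta (mor_comp X G f (cov_proj L S p)) y =
      hom_v f (fst (ghead X y)) (cov_delta L S p y) \<otimes>\<^bsub>vgrp G (on_v f (fst (ghead X y)))\<^esub> delta f (fst y)"
  by (auto simp: mor_comp_def cov_proj_def Let_def)

lemma on_v_cov_comp [simp]: "on_v (mor_comp X G (cov_proj G R q) F) x = fst (on_v F x)"
  and on_e_cov_comp [simp]: "on_e (mor_comp X G (cov_proj G R q) F) y = map_sum fst fst (on_e F y)"
  and hom_v_cov_comp [simp]:
    "hom_v (mor_comp X G (cov_proj G R q) F) x g = \<one>\<^bsub>vgrp G (fst (on_v F x))\<^esub>"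
  and hom_e_cov_comp [simp]:
    "hom_e (mor_comp X G (cov_proj G R q) F) y h = \<one>\<^bsub>cell_grp G (map_sum fst fst (on_e F y))\<^esub>"
  and delta_cov_comp [simp]:
    "delta (mor_comp X G (cov_proj G R q) F) y =
      \<one>\<^bsub>vgrp G (fst (on_v F (ghead X y)))\<^esub> \<otimes>\<^bsub>vgrp G (fst (on_v F (ghead X y)))\<^esub>
      (case on_e F y of Inl _ \<Rightarrow> \<one>\<^bsub>vgrp G (fst (on_v F (ghead X y)))\<^esub> | Inr y' \<Rightarrow> cov_delta G R q y')"
  by (auto simp: mor_comp_def cov_proj_def Let_def split: sum.splits)

lemma unit_groups [simp]:
  "vgrp (bs_tree X q) x = singleton_group ()" "egrp (bs_tree X q) y = singleton_group ()"
  by (simp_all add: bs_tree_def Let_def)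

section \<open>Construction of the lift\<close>

definition nform_of :: "('v, 'e, 'g) bs_v \<Rightarrow> ('g \<times> 'e) list" where
  "nform_of x = (THE ns. L.nform (fst x) ns \<and> x = L.tvert (fst x) ns)"

lemma nform_of_tvert: "L.nform v ns \<Longrightarrow> nform_of (L.tvert v ns) = ns"
  unfolding nform_of_def by (rule the_equality) (auto simp: L.tvert_eq_iff)

text \<open>This is \<open>dev\<close> in terms of the arc alone: the representative
  \<open>s\<close> of an arc is recovered as the covering \<open>delta\<close> at its
  reverse.\<close>

definition arc_dev :: "('v, 'e, 'g) bs_e \<Rightarrow> 'k" where
  "arc_dev y = dev (fst y) (nform_of (gtail L.T y)) (cov_delta L S p (opp L.T y))"

lemma tarc_flip:
  assumes e: "e \<in> garcs L" and ns: "L.nform (gtail L e) ns" and s: "s \<in> S (opp L e)"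
    and flip: "L.flip ns s e = (ns', t)"
  shows "cov_delta L S p (L.tarc e ns s) = t" "cov_delta L S p (opp L.T (L.tarc e ns s)) = s"
    "opp L.T (L.tarc e ns s) = L.tarc (opp L e) ns' t"
    "gtail L.T (L.tarc e ns s) = L.tvert (gtail L e) ns"
    "ghead L.T (L.tarc e ns s) = L.tvert (ghead L e) ns'"
    "arc_dev (L.tarc e ns s) = dev e ns s" "arc_dev (opp L.T (L.tarc e ns s)) = dev (opp L e) ns' t"
proof -
  note ff = L.flip_flip[OF e ns s flip]
  show 1: "cov_delta L S p (L.tarc e ns s) = t" using L.cov_delta_tarc assms by metis
  show 2: "opp L.T (L.tarc e ns s) = L.tarc (opp L e) ns' t" using L.opp_tarc assms by metis
  show 3: "cov_delta L S p (opp L.T (L.tarc e ns s)) = s"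
    unfolding 2 using L.cov_delta_tarc[of "opp L e" ns' t ns s] e ff by simp
  show 4: "gtail L.T (L.tarc e ns s) = L.tvert (gtail L e) ns" using L.tail_tarc assms by metis
  show "ghead L.T (L.tarc e ns s) = L.tvert (ghead L e) ns'" using L.head_tarc assms by metis
  show "arc_dev (L.tarc e ns s) = dev e ns s"
    unfolding arc_dev_def 3 4 using ns by (simp add: nform_of_tvert)
  have "opp L.T (L.tarc (opp L e) ns' t) = L.tarc e ns s"
    using L.opp_tarc[of "opp L e" ns' t ns s] e ff by simp
  then show "arc_dev (opp L.T (L.tarc e ns s)) = dev (opp L e) ns' t"
    unfolding arc_dev_def 2 using 1 L.tail_tarc[of "opp L e" ns' t] e ff
    by (simp add: nform_of_tvert)
qed

text \<open>The image of an uncollapsed arc \<open>y\<close> is the class of the image of its normal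
  form path followed by the \<open>delta\<close> factor, so only the coset of
  \<open>arc_dev y\<close> enters. The group data are forced, since the groups of the trees are
  trivial.\<close>

definition lift ::
  "(('v, 'e, 'g) bs_v, ('v, 'e, 'g) bs_e, unit, ('w, 'd, 'k) bs_v, ('w, 'd, 'k) bs_e, unit) gog_mor" where
  "lift =
    \<lparr>on_v = (\<lambda>x. G.tvert (on_v f (fst x)) (fst (img (nform_of x)))),
     on_e = (\<lambda>y. case on_e f (fst y) of
        Inl w \<Rightarrow> Inl (G.tvert w (fst (img (nform_of (gtail L.T y)))))
      | Inr d \<Rightarrow> Inr (G.tarc d (fst (img (nform_of (gtail L.T y)))) (G.rep (opp G d) (arc_dev y)))),
     hom_v = (\<lambda>_ _. ()), hom_e = (\<lambda>_ _. ()), delta = (\<lambda>_. ())\<rparr>"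

lemma lift_tvert: "L.nform v ns \<Longrightarrow> on_v lift (L.tvert v ns) = G.tvert (on_v f v) (fst (img ns))"
  by (simp add: lift_def nform_of_tvert)

lemma lift_tarc:
  assumes "e \<in> garcs L" "L.nform (gtail L e) ns" "s \<in> S (opp L e)"
  shows "on_e lift (L.tarc e ns s) = (case on_e f e of Inl w \<Rightarrow> Inl (G.tvert w (fst (img ns)))
    | Inr d \<Rightarrow> Inr (G.tarc d (fst (img ns)) (G.rep (opp G d) (dev e ns s))))"
proof -
  obtain ns' t where "L.flip ns s e = (ns', t)" by force
  note * = tarc_flip[OF assms this]
  show ?thesis unfolding lift_def using *(4,6) assms by (simp add: nform_of_tvert split: sum.split)
qed

lemma G_tarc_dev:
  assumes e: "e \<in> garcs L" and ns: "L.nform (gtail L e) ns" and s: "s \<in> S (opp L e)"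
    and flip: "L.flip ns s e = (ns', t)" and d: "on_e f e = Inr d"
  shows "G.tarc d (fst (img ns)) (G.rep (opp G d) (dev e ns s)) \<in> garcs G.T"
    "ghead G.T (G.tarc d (fst (img ns)) (G.rep (opp G d) (dev e ns s))) = G.tvert (ghead G d) (fst (img ns'))"
    "opp G.T (G.tarc d (fst (img ns)) (G.rep (opp G d) (dev e ns s))) =
      G.tarc (opp G d) (fst (img ns')) (G.rep d (dev (opp L e) ns' t))"
    "cov_delta G R (on_v f p) (G.tarc d (fst (img ns)) (G.rep (opp G d) (dev e ns s))) =
      G.rep d (dev (opp L e) ns' t)"
proof -
  note D = on_e_InrD[OF e d]
  have 1: "G.nform (gtail G d) (fst (img ns))" using nform_img[OF ns] D by simp
  have 2: "G.rep (opp G d) (dev e ns s) \<in> R (opp G d)"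
    using G.rep_res(1)[of "opp G d"] dev_closed[OF e ns s] D by simp
  note 3 = dev_flip_Inr(1)[OF assms]
  show "G.tarc d (fst (img ns)) (G.rep (opp G d) (dev e ns s)) \<in> garcs G.T"
    "ghead G.T (G.tarc d (fst (img ns)) (G.rep (opp G d) (dev e ns s))) = G.tvert (ghead G d) (fst (img ns'))"
    "opp G.T (G.tarc d (fst (img ns)) (G.rep (opp G d) (dev e ns s))) =
      G.tarc (opp G d) (fst (img ns')) (G.rep d (dev (opp L e) ns' t))"
    "cov_delta G R (on_v f p) (G.tarc d (fst (img ns)) (G.rep (opp G d) (dev e ns s))) =
      G.rep d (dev (opp L e) ns' t)"
    using G.tarc_in_T[OF D(1) 1 2] G.head_tarc[OF D(1) 1 2 3] G.opp_tarc[OF D(1) 1 2 3]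
      G.cov_delta_tarc[OF D(1) 1 2 3] by auto
qed

text \<open>Incidence and reversal are read off from the states at the two ends of an arc, by
  \<open>dev_flip_Inl\<close> if it is collapsed and by \<open>G_tarc_dev\<close> otherwise.\<close>

lemma lift_morphism: "gog_morphism L.T G.T lift"
proof -
  have "on_v lift x \<in> gverts G.T" if x: "x \<in> gverts L.T" for x
    using x nform_img lift_tvert unfolding L.verts_T G.verts_T by fastforce
  moreover have "cell_in G.T (on_e lift y) \<and> cell_head G.T (on_e lift y) = on_v lift (ghead L.T y) \<and>
      on_e lift (opp L.T y) = cell_opp G.T (on_e lift y)" if y: "y \<in> garcs L.T" for y
  proof -
    obtain e ns s ns' t where *: "y = L.tarc e ns s" "e \<in> garcs L" "L.nform (gtail L e) ns" "s \<in> S (opp L e)"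
      "L.flip ns s e = (ns', t)"
      using L.arcs_T_tail_E[OF y] by metis
    note ff = L.flip_flip[OF *(2-5)]
    note tf = tarc_flip[OF *(2-5)]
    have opp: "on_e lift (opp L.T y) = (case on_e f (opp L e) of Inl w \<Rightarrow> Inl (G.tvert w (fst (img ns')))
      | Inr d \<Rightarrow> Inr (G.tarc d (fst (img ns')) (G.rep (opp G d) (dev (opp L e) ns' t))))"
      using lift_tarc[of "opp L e" ns' t] * ff tf(3) by simp
    have head: "on_v lift (ghead L.T y) = G.tvert (on_v f (ghead L e)) (fst (img ns'))"
      using * tf(5) ff by (simp add: lift_tvert)
    show ?thesis
    proof (cases "on_e f e")
      case (Inl w)
      have "G.nform w (fst (img ns))" using nform_img[OF *(3)] on_e_InlD[OF *(2) Inl] by simp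
      then have "G.tvert w (fst (img ns)) \<in> gverts G.T" unfolding G.verts_T by blast
      then show ?thesis
        using on_e_InlD[OF *(2) Inl] dev_flip_Inl[OF *(2-5) Inl] lift_tarc[OF *(2-4)] opp head *(1) Inl by simp
    next
      case (Inr d)
      then show ?thesis
        using on_e_InrD[OF *(2) Inr] G_tarc_dev[OF *(2-5) Inr] lift_tarc[OF *(2-4)] opp head *(1) by simp
    qed
  qed
  moreover have "hom_v lift x = (\<lambda>_. ())" "hom_e lift y = (\<lambda>_. ())" "delta lift y = ()" for x y
    by (simp_all add: lift_def)
  moreover have "cell_grp G.T c = singleton_group ()" for c by (cases c) simp_all
  ultimately show ?thesis
    by (simp add: gog_morphism_def Let_def hom_def singleton_group_def)
qed

lemma lift_is_lift: "is_lift L S G R f p lift"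
proof -
  define k where "k x = snd (img (nform_of x))" for x
  \<comment> \<open>On a collapsed arc the covering projection of \<open>G\<close> contributes no
    \<open>delta\<close>, so \<open>l\<close> has to absorb the whole deviation; otherwise it
    absorbs the edge group factor and leaves the coset representative.\<close>
  define l where "l y = (case on_e f (fst y) of Inl w \<Rightarrow> arc_dev (opp L.T y) | Inr d \<Rightarrow> G.res d (arc_dev (opp L.T y)))" for y
  have k: "k (L.tvert v ns) = snd (img ns)" if "L.nform v ns" for v ns
    using that by (simp add: k_def nform_of_tvert)
  have verts: "fst (on_v lift x) = on_v f (fst x) \<and> k x \<in> carrier (vgrp G (on_v f (fst x))) \<and>
      \<one>\<^bsub>vgrp G (on_v f (fst x))\<^esub> = k x \<otimes>\<^bsub>vgrp G (on_v f (fst x))\<^esub> hom_v f (fst x) \<one>\<^bsub>vgrp L (fst x)\<^esub>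
        \<otimes>\<^bsub>vgrp G (on_v f (fst x))\<^esub> inv\<^bsub>vgrp G (on_v f (fst x))\<^esub> (k x)"
    if x: "x \<in> gverts L.T" for x
  proof -
    obtain v ns where v: "x = L.tvert v ns" "L.nform v ns" using x unfolding L.verts_T by blast
    have vL: "v \<in> gverts L" using L.nform_verts v by blast
    interpret M: group "vgrp G (on_v f v)" using vL on_v_in G.group_vgrp by simp
    show ?thesis using v vL k img_closed by (simp add: lift_tvert hom_v_one)
  qed
  have arcs: "map_sum fst fst (on_e lift y) = on_e f (fst y) \<and> l y \<in> carrier (cell_grp G (on_e f (fst y))) \<and>
      l (opp L.T y) = l y \<and>
      (let N = cell_grp G (on_e f (fst y)); M = vgrp G (on_v f (fst (ghead L.T y))) in
        \<one>\<^bsub>N\<^esub> = l y \<otimes>\<^bsub>N\<^esub> hom_e f (fst y) \<one>\<^bsub>egrp L (fst y)\<^esub> \<otimes>\<^bsub>N\<^esub> inv\<^bsub>N\<^esub> (l y) \<and>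
        \<one>\<^bsub>M\<^esub> \<otimes>\<^bsub>M\<^esub> (case on_e lift y of Inl _ \<Rightarrow> \<one>\<^bsub>M\<^esub> | Inr y' \<Rightarrow> cov_delta G R (on_v f p) y') =
          k (ghead L.T y) \<otimes>\<^bsub>M\<^esub> (hom_v f (fst (ghead L.T y)) (cov_delta L S p y) \<otimes>\<^bsub>M\<^esub> delta f (fst y))
          \<otimes>\<^bsub>M\<^esub> inv\<^bsub>M\<^esub> (cell_inc G (on_e f (fst y)) (l y)))"
    if y: "y \<in> garcs L.T" for y
  proof -
    obtain e ns s ns' t where *: "y = L.tarc e ns s" "e \<in> garcs L" "L.nform (gtail L e) ns" "s \<in> S (opp L e)"
      "L.flip ns s e = (ns', t)"
      using L.arcs_T_tail_E[OF y] by metis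
    note ff = L.flip_flip[OF *(2-5)]
    note tf = tarc_flip[OF *(2-5)]
    have fy: "fst y = e" "fst (opp L.T y) = opp L e" "opp L.T (opp L.T y) = y" "fst (ghead L.T y) = ghead L e"
      using * tf L.opp_tarc[of "opp L e" ns' t ns s] ff by auto
    let ?M = "vgrp G (on_v f (ghead L e))"
    interpret M: group ?M using *(2) on_v_in G.group_vgrp by simp
    interpret N: group "cell_grp G (on_e f e)" using hom_e_one *(2) by simp
    have b': "dev (opp L e) ns' t \<in> carrier ?M"
      using dev_closed[of "opp L e" ns' t] * ff by simp
    \<comment> \<open>The right side of the square at \<open>y\<close>, before the correction by
      \<open>l\<close>, is the deviation of the reversed arc.\<close>
    have k': "k (ghead L.T y) \<otimes>\<^bsub>?M\<^esub> (hom_v f (ghead L e) (cov_delta L S p y) \<otimes>\<^bsub>?M\<^esub> delta f e) = dev (opp L e) ns' t"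
      using * tf ff k by (simp add: dev_def)
    show ?thesis
    proof (cases "on_e f e")
      case (Inl w)
      note I = on_e_InlD[OF *(2) Inl] dev_flip_Inl[OF *(2-5) Inl]
      have ly: "l y = dev (opp L e) ns' t" "l (opp L.T y) = dev (opp L e) ns' t"
        using * tf I fy Inl unfolding l_def by auto
      show ?thesis
        unfolding fy Let_def k' ly
        using ly b' I hom_e_one(2)[OF *(2)] M.r_one[OF b'] M.l_one[OF M.one_closed] M.r_inv[OF b'] Inl lift_tarc[OF *(2-4)] *(1) by simp
    next
      case (Inr d)
      note I = on_e_InrD[OF *(2) Inr] dev_flip_Inr[OF *(2-5) Inr] G_tarc_dev[OF *(2-5) Inr]
      have ly: "l y = G.res d (dev (opp L e) ns' t)" "l (opp L.T y) = G.res d (dev (opp L e) ns' t)"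
        using * tf I fy Inr unfolding l_def by auto
      have b'': "dev (opp L e) ns' t \<in> carrier (vgrp G (ghead G d))" using b' I by simp
      note r = G.rep_res[OF I(1) b'']
      interpret D: group "vgrp G (ghead G d)" using I G.group_vgrp by simp
      interpret E: group "egrp G d" using I G.group_egrp by simp
      have inc: "inc G d (G.res d (dev (opp L e) ns' t)) \<in> carrier ?M"
        using G.inc_closed[OF I(1) r(3)] I by simp
      \<comment> \<open>Solve the factorization of the deviation for the representative, which is
        the covering \<open>delta\<close> at the image arc by \<open>G_tarc_dev\<close>.\<close>
      have "G.rep d (dev (opp L e) ns' t) =
          dev (opp L e) ns' t \<otimes>\<^bsub>?M\<^esub> inv\<^bsub>?M\<^esub> inc G d (G.res d (dev (opp L e) ns' t))"
        using r b' inc I(4) by (simp add: D.inv_solve_right)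
      then show ?thesis
        unfolding fy Let_def k' ly
        using ly r b' inc I hom_e_one(2)[OF *(2)] Inr lift_tarc[OF *(2-4)] *(1) by simp
    qed
  qed
  have base: "on_v lift (bs_base L p) = bs_base G (on_v f p)" "k (bs_base L p) = \<one>\<^bsub>vgrp G (on_v f p)\<^esub>"
    "fst (bs_base L p) = p"
    by (simp_all add: L.bs_base_tvert G.bs_base_tvert lift_tvert k img_Nil)
  have "pointed_mor_equiv L.T G (bs_base L p) (mor_comp L.T G f (cov_proj L S p))
      (mor_comp L.T G (cov_proj G R (on_v f p)) lift)"
    unfolding pointed_mor_equiv_def
  proof (intro conjI ballI exI[of _ k] exI[of _ l])
    fix y assume y: "y \<in> garcs L.T"
    have hd: "fst (on_v lift (ghead L.T y)) = on_v f (fst (ghead L.T y))"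
      using verts[of "ghead L.T y"] y L.arcs_T_tail_E[OF y] tarc_flip(5) L.flip_flip(1)
      unfolding L.verts_T by (metis (mono_tags, lifting) mem_Collect_eq)
    show "let M = vgrp G (on_v (mor_comp L.T G f (cov_proj L S p)) (ghead L.T y));
              N = cell_grp G (on_e (mor_comp L.T G f (cov_proj L S p)) y)
          in l y \<in> carrier N \<and> l (opp L.T y) = l y \<and>
             (\<forall>h\<in>carrier (egrp L.T y). hom_e (mor_comp L.T G (cov_proj G R (on_v f p)) lift) y h =
                l y \<otimes>\<^bsub>N\<^esub> hom_e (mor_comp L.T G f (cov_proj L S p)) y h \<otimes>\<^bsub>N\<^esub> inv\<^bsub>N\<^esub> l y) \<and>
             delta (mor_comp L.T G (cov_proj G R (on_v f p)) lift) y =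
             k (ghead L.T y) \<otimes>\<^bsub>M\<^esub> delta (mor_comp L.T G f (cov_proj L S p)) y \<otimes>\<^bsub>M\<^esub>
             inv\<^bsub>M\<^esub> cell_inc G (on_e (mor_comp L.T G f (cov_proj L S p)) y) (l y)"
      using arcs[OF y] unfolding Let_def by (simp add: hd cong: sum.case_cong)
  qed (use verts arcs base in \<open>auto simp: Let_def\<close>)
  then show ?thesis using lift_morphism base unfolding is_lift_def Let_def by simp
qed

section \<open>Uniqueness of the lift\<close>

text \<open>The inductive step for uniqueness. Commutativity at the reversed arc, where
  \<open>k\<close> is known, determines \<open>l\<close> on the arc and, if the arc is not
  collapsed, its image as well. Commutativity at the arc itself then yields \<open>k\<close> at the
  head.\<close>

lemma is_lift_arc:
  assumes F: "gog_morphism L.T G.T F"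
    and on_e: "\<forall>y\<in>garcs L.T. map_sum fst fst (on_e F y) = on_e f (fst y)"
    and on_v: "\<forall>x\<in>gverts L.T. fst (on_v F x) = on_v f (fst x)"
    and k: "\<forall>x\<in>gverts L.T. k x \<in> carrier (vgrp G (on_v f (fst x)))"
    and l: "\<forall>y\<in>garcs L.T. l y \<in> carrier (cell_grp G (on_e f (fst y))) \<and> l (opp L.T y) = l y"
    and delta: "\<forall>y\<in>garcs L.T. delta (mor_comp L.T G (cov_proj G R (on_v f p)) F) y =
      k (ghead L.T y) \<otimes>\<^bsub>vgrp G (on_v f (fst (ghead L.T y)))\<^esub> delta (mor_comp L.T G f (cov_proj L S p)) y
      \<otimes>\<^bsub>vgrp G (on_v f (fst (ghead L.T y)))\<^esub>
      inv\<^bsub>vgrp G (on_v f (fst (ghead L.T y)))\<^esub> (cell_inc G (on_e f (fst y)) (l y))"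
    and e: "e \<in> garcs L" and ns: "L.nform (gtail L e) ns" and s: "s \<in> S (opp L e)"
    and flip: "L.flip ns s e = (ns', t)"
    and tail: "on_v F (L.tvert (gtail L e) ns) = G.tvert (on_v f (gtail L e)) (fst (img ns))"
      "k (L.tvert (gtail L e) ns) = snd (img ns)"
  shows "on_e F (L.tarc e ns s) = on_e lift (L.tarc e ns s)"
    and "on_v F (L.tvert (ghead L e) ns') = G.tvert (on_v f (ghead L e)) (fst (img ns'))"
    and "k (L.tvert (ghead L e) ns') = snd (img ns')"
proof -
  note on_e = on_e[THEN bspec] and on_v = on_v[THEN bspec] and k = k[THEN bspec]
    and l = l[THEN bspec] and delta = delta[THEN bspec]
  note ff = L.flip_flip[OF e ns s flip]
  note tf = tarc_flip[OF e ns s flip]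
  have oe: "opp L e \<in> garcs L" "L.nform (gtail L (opp L e)) ns'" "t \<in> S (opp L (opp L e))"
    using e ff by simp_all
  define y where "y = L.tarc e ns s"
  define y' where "y' = L.tarc (opp L e) ns' t"
  have yT: "y \<in> garcs L.T" "y' \<in> garcs L.T" "opp L.T y = y'" "fst y = e" "fst y' = opp L e"
    using L.tarc_in_T[OF e ns s] L.tarc_in_T[OF oe] tf by (auto simp: y_def y'_def)
  have heads: "ghead L.T y = L.tvert (ghead L e) ns'" "ghead L.T y' = L.tvert (gtail L e) ns"
    using tf(5) L.head_tarc[OF oe, of ns s] ff e by (simp_all add: y_def y'_def)
  have hT: "L.tvert (ghead L e) ns' \<in> gverts L.T" using ff(1) unfolding L.verts_T by blast
  let ?M = "vgrp G (on_v f (ghead L e))" and ?N = "vgrp G (on_v f (gtail L e))"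
  interpret M: group ?M using e on_v_in G.group_vgrp by simp
  interpret N: group ?N using e on_v_in G.group_vgrp by simp
  define b where "b = dev e ns s"
  \<comment> \<open>If \<open>k\<close> has the expected value at the head, this is the deviation of
    the reversed arc. Conversely, equality with that deviation gives the value of \<open>k\<close>
    by cancellation, in \<open>kI\<close>.\<close>
  define c where "c = k (L.tvert (ghead L e) ns') \<otimes>\<^bsub>?M\<^esub> (hom_v f (ghead L e) t \<otimes>\<^bsub>?M\<^esub> delta f e)"
  have b: "b \<in> carrier ?N" using dev_closed[OF e ns s] by (simp add: b_def)
  have kM: "k (L.tvert (ghead L e) ns') \<in> carrier ?M" using k[OF hT] by simp
  have ht: "hom_v f (ghead L e) t \<otimes>\<^bsub>?M\<^esub> delta f e \<in> carrier ?M"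
    using hom_v_rep_closed[OF oe] arc_morphism(5)[OF e] e by simp
  have c: "c \<in> carrier ?M" using kM ht by (simp add: c_def)
  have dev': "dev (opp L e) ns' t = snd (img ns') \<otimes>\<^bsub>?M\<^esub> (hom_v f (ghead L e) t \<otimes>\<^bsub>?M\<^esub> delta f e)"
    using e by (simp add: dev_def)
  have kI: "k (L.tvert (ghead L e) ns') = snd (img ns')" if "c = dev (opp L e) ns' t"
    using that kM ht img_closed[OF ff(1)] unfolding c_def dev' by simp
  have cy: "cov_delta L S p y = t" using tf(1) by (simp add: y_def)
  have d1: "\<one>\<^bsub>?M\<^esub> \<otimes>\<^bsub>?M\<^esub> (case on_e F y of Inl _ \<Rightarrow> \<one>\<^bsub>?M\<^esub> | Inr z \<Rightarrow> cov_delta G R (on_v f p) z) =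
      c \<otimes>\<^bsub>?M\<^esub> inv\<^bsub>?M\<^esub> (cell_inc G (on_e f e) (l y))"
    using delta[OF yT(1)] cy on_v[OF hT] by (simp add: heads yT c_def cong: sum.case_cong)
  have tT: "L.tvert (gtail L e) ns \<in> gverts L.T" using ns unfolding L.verts_T by blast
  have "cov_delta L S p y' = s" using tf(2,3) by (simp add: y'_def)
  \<comment> \<open>Commutativity at the reversed arc: its head is the original tail, where
    \<open>k\<close> is known, so the right side involves the known element
    \<open>b\<close>.\<close>
  then have d2: "\<one>\<^bsub>?N\<^esub> \<otimes>\<^bsub>?N\<^esub> (case on_e F y' of Inl _ \<Rightarrow> \<one>\<^bsub>?N\<^esub> | Inr z \<Rightarrow> cov_delta G R (on_v f p) z) =
      b \<otimes>\<^bsub>?N\<^esub> inv\<^bsub>?N\<^esub> (cell_inc G (on_e f (opp L e)) (l y))"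
    using delta[OF yT(2)] on_v[OF tT] l[OF yT(1)] tail(2) by (simp add: heads yT b_def dev_def cong: sum.case_cong)
  have Fy: "cell_head G.T (on_e F y) = on_v F (L.tvert (ghead L e) ns')" "on_e F y' = cell_opp G.T (on_e F y)"
    "cell_in G.T (on_e F y)"
    using F yT(1) unfolding gog_morphism_def heads[symmetric] yT(3)[symmetric] by auto
  have Fy': "cell_head G.T (on_e F y') = on_v F (L.tvert (gtail L e) ns)"
    using F yT(2) unfolding gog_morphism_def heads[symmetric] by auto
  have "on_e F y = on_e lift y \<and> on_v F (L.tvert (ghead L e) ns') = G.tvert (on_v f (ghead L e)) (fst (img ns')) \<and>
    c = dev (opp L e) ns' t"
  proof (cases "on_e f e")
    case (Inl w)
    note I = on_e_InlD[OF e Inl] dev_flip_Inl[OF e ns s flip Inl]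
    interpret W: group "vgrp G w" using N.group_axioms I(2) by simp
    obtain x where x: "on_e F y = Inl x" using on_e[OF yT(1)] Inl yT by (cases "on_e F y") auto
    have ly: "l y \<in> carrier ?M" using l[OF yT(1)] yT(4) Inl I by simp
    \<comment> \<open>With no \<open>delta\<close> from the covering projection, the equations at
      both ends say that the deviation is \<open>l y\<close>.\<close>
    have "c = l y" using d1 x Inl c ly by (simp add: M.inv_solve_right)
    moreover have "b = l y" using d2 x Fy Inl b ly I by (simp add: W.inv_solve_right)
    ultimately show ?thesis
      using x Fy Fy' tail(1) I lift_tarc[OF e ns s] Inl by (simp add: y_def b_def)
  next
    case (Inr d)
    note I = on_e_InrD[OF e Inr]
    interpret D: group "vgrp G (ghead G d)" using I G.group_vgrp by simp
    interpret D': group "vgrp G (gtail G d)" using I G.group_vgrp by simp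
    obtain z where z: "on_e F y = Inr z" "fst z = d"
      using on_e[OF yT(1)] Inr yT by (cases "on_e F y") auto
    have "z \<in> garcs G.T" using Fy(3) z by simp
    then obtain d' ms r ms' u where *: "z = G.tarc d' ms r" "d' \<in> garcs G" "G.nform (gtail G d') ms"
      "r \<in> R (opp G d')" "G.flip ms r d' = (ms', u)"
      using G.arcs_T_tail_E by metis
    then have [simp]: "d' = d" using z by simp
    note * = *[simplified]
    note gf = G.flip_flip[OF *(2-5)]
    have oz: "on_e F y' = Inr (G.tarc (opp G d) ms' u)" using Fy(2) z G.opp_tarc[OF *(2-5)] *(1) by simp
    \<comment> \<open>The image arc starts at the image of the tail, which fixes its word; only the
      representative \<open>r\<close> is still open.\<close>
    have "G.tvert (gtail G d) ms = G.tvert (gtail G d) (fst (img ns))"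
      using Fy' oz tail(1) I(3) G.head_tarc[of "opp G d" ms' u ms r] gf *(2) by simp
    then have ms: "ms = fst (img ns)" using *(3) nform_img[OF ns] I(3) by (simp add: G.tvert_eq_iff)
    have ly: "l y \<in> carrier (egrp G d)" using l[OF yT(1)] yT(4) Inr by simp
    have rc: "r \<in> carrier (vgrp G (gtail G d))" using G.transversalD(1)[of "opp G d"] * by auto
    have uc: "u \<in> carrier (vgrp G (ghead G d))" using G.transversalD(1)[of d] * gf by auto
    have "cov_delta G R (on_v f p) (G.tarc (opp G d) ms' u) = r"
      using G.cov_delta_tarc[of "opp G d" ms' u ms r] gf *(2) by simp
    then have bb: "b = r \<otimes>\<^bsub>vgrp G (gtail G d)\<^esub> inc G (opp G d) (l y)"
      using d2 oz I rc b G.inc_opp_closed[OF *(2) ly] by (simp add: D'.m_assoc)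
    have cc: "c = u \<otimes>\<^bsub>vgrp G (ghead G d)\<^esub> inc G d (l y)"
      using d1 z *(1) G.cov_delta_tarc[OF *(2-5)] I Inr uc c G.inc_closed[OF *(2) ly]
      by (simp add: D.m_assoc)
    \<comment> \<open>The factorization \<open>bb\<close> exhibits \<open>r\<close> as the
      representative of the known element \<open>b\<close>, as in the definition of
      \<open>lift\<close>.\<close>
    have rep: "G.rep (opp G d) b = r"
      using G.rep_res_eqI(1)[of "opp G d" r "l y"] * ly bb by (simp add: G.egrp_opp)
    \<comment> \<open>Crossing \<open>d\<close> carries the factor \<open>l y\<close> along and so
      turns the final element \<open>b\<close> into \<open>c\<close>, while \<open>dev_flip\<close>
      says where this crossing leads.\<close>
    have "(fst (img ns'), dev (opp L e) ns' t) = (ms', c)"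
      using dev_flip[OF e ns s flip] Inr G.step_Arc[OF *(2,4) ly *(5)]
      by (simp add: ms[symmetric] b_def[symmetric] bb cc del: G.step.simps)
    then show ?thesis
      using z *(1) Fy(1) lift_tarc[OF e ns s] Inr rep ms I G.head_tarc[OF *(2-5)]
      by (simp add: y_def b_def)
  qed
  then show "on_e F (L.tarc e ns s) = on_e lift (L.tarc e ns s)"
    "on_v F (L.tvert (ghead L e) ns') = G.tvert (on_v f (ghead L e)) (fst (img ns'))"
    "k (L.tvert (ghead L e) ns') = snd (img ns')"
    using kI by (auto simp: y_def)
qed

text \<open>Induction on the word of a vertex, that is, along the tight path from the base, where
  \<open>k\<close> is trivial. The values on arcs follow from those at their tails.\<close>

lemma is_lift_unique:
  assumes "is_lift L S G R f p F"
  shows "mor_eq L.T F lift"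
proof -
  have F: "gog_morphism L.T G.T F" and base: "on_v F (bs_base L p) = bs_base G (on_v f p)"
    and eq: "pointed_mor_equiv L.T G (bs_base L p) (mor_comp L.T G f (cov_proj L S p))
      (mor_comp L.T G (cov_proj G R (on_v f p)) F)"
    using assms by (auto simp: is_lift_def Let_def)
  have on_v: "\<forall>x\<in>gverts L.T. fst (on_v F x) = on_v f (fst x)"
    using eq by (auto simp: pointed_mor_equiv_def)
  have on_e: "\<forall>y\<in>garcs L.T. map_sum fst fst (on_e F y) = on_e f (fst y)"
    using eq by (auto simp: pointed_mor_equiv_def)
  obtain k l where k0: "k (bs_base L p) = \<one>\<^bsub>vgrp G (on_v f (fst (bs_base L p)))\<^esub>"
    and k: "\<forall>x\<in>gverts L.T. k x \<in> carrier (vgrp G (on_v f (fst x)))"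
    and l: "\<forall>y\<in>garcs L.T. l y \<in> carrier (cell_grp G (on_e f (fst y))) \<and> l (opp L.T y) = l y"
    and delta: "\<forall>y\<in>garcs L.T. delta (mor_comp L.T G (cov_proj G R (on_v f p)) F) y =
      k (ghead L.T y) \<otimes>\<^bsub>vgrp G (on_v f (fst (ghead L.T y)))\<^esub> delta (mor_comp L.T G f (cov_proj L S p)) y
      \<otimes>\<^bsub>vgrp G (on_v f (fst (ghead L.T y)))\<^esub>
      inv\<^bsub>vgrp G (on_v f (fst (ghead L.T y)))\<^esub> (cell_inc G (on_e f (fst y)) (l y))"
    using eq unfolding pointed_mor_equiv_def Let_def on_v_comp_cov on_e_comp_cov
    by blast
  note arc = is_lift_arc[OF F on_e on_v k l delta]
  have vert: "on_v F (L.tvert v ns) = G.tvert (on_v f v) (fst (img ns)) \<and> k (L.tvert v ns) = snd (img ns)"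
    if "L.nform v ns" for v ns
    using that
  proof (induction ns arbitrary: v rule: rev_induct)
    case Nil
    then show ?case using base k0 by (simp add: L.bs_base_tvert G.bs_base_tvert img_Nil)
  next
    case (snoc x ns)
    obtain s e where x: "x = (s, e)" by force
    with snoc.prems have e: "e \<in> garcs L" "L.nform (gtail L e) ns" "s \<in> S (opp L e)" "ghead L e = v"
      "L.flip ns s e = (ns @ [(s, e)], \<one>\<^bsub>vgrp L v\<^esub>)"
      by (auto simp: L.nform_snoc L.flip_def)
    show ?case using arc(2,3)[OF e(1-3,5)] snoc.IH[OF e(2)] e(4) x by simp
  qed
  have "on_v F x = on_v lift x" if "x \<in> gverts L.T" for x
    using that vert lift_tvert unfolding L.verts_T by auto
  moreover have "on_e F y = on_e lift y" if y: "y \<in> garcs L.T" for y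
  proof -
    obtain e ns s ns' t where *: "y = L.tarc e ns s" "e \<in> garcs L" "L.nform (gtail L e) ns" "s \<in> S (opp L e)"
      "L.flip ns s e = (ns', t)"
      using L.arcs_T_tail_E[OF y] by metis
    show ?thesis using arc(1)[OF *(2-5)] vert[OF *(3)] *(1) by simp
  qed
  ultimately show ?thesis by (simp add: mor_eq_def)
qed

end

lemma mor_eq_right_euclidean: "mor_eq L f h \<Longrightarrow> mor_eq L f' h \<Longrightarrow> mor_eq L f f'"
  by (simp add: mor_eq_def)

text \<open>Any two lifts agree with the explicit \<open>lift\<close>, hence with each
  other.\<close>

lemma gog_data_has_unique_lift:
  assumes "gog_data L" "gog_data G" "gog_morphism L G f" "p \<in> gverts L"
  shows "has_unique_lift L G f p"
  unfolding has_unique_lift_def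
proof (intro allI impI)
  fix S R assume "transversal L S \<and> transversal G R"
  moreover have "on_v f p \<in> gverts G" using assms by (auto simp: gog_morphism_def)
  ultimately interpret gog_lift L S p G R f
    using assms by (simp add: gog_lift_def gog_mor_def gog_mor_axioms_def gog_cover_def gog_cover_axioms_def)
  show "(\<exists>F. is_lift L S G R f p F) \<and>
      (\<forall>F F'. is_lift L S G R f p F \<and> is_lift L S G R f p F' \<longrightarrow> mor_eq L.T F F')"
    using lift_is_lift is_lift_unique mor_eq_right_euclidean by blast
qed

section \<open>Subdivision\<close>

lemma subdivide_at_simps [simp]:
  "gverts (subdivide_at G A) = Old ` gverts G \<union> (\<lambda>e. Mid {e, opp G e}) ` A"
  "garcs (subdivide_at G A) = Whole ` (garcs G - A) \<union> Initial ` A \<union> Terminal ` A"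
  "gtail (subdivide_at G A) (Whole e) = Old (gtail G e)"
  "gtail (subdivide_at G A) (Initial e) = Old (gtail G e)"
  "gtail (subdivide_at G A) (Terminal e) = Mid {e, opp G e}"
  "ghead (subdivide_at G A) (Whole e) = Old (ghead G e)"
  "ghead (subdivide_at G A) (Initial e) = Mid {e, opp G e}"
  "ghead (subdivide_at G A) (Terminal e) = Old (ghead G e)"
  "opp (subdivide_at G A) (Whole e) = (if e \<in> A then Whole e else Whole (opp G e))"
  "opp (subdivide_at G A) (Initial e) = (if e \<in> A then Terminal (opp G e) else Initial e)"
  "opp (subdivide_at G A) (Terminal e) = (if e \<in> A then Initial (opp G e) else Terminal e)"
  "vgrp (subdivide_at G A) (Old v) = vgrp G v"
  "vgrp (subdivide_at G A) (Mid m) = egrp G (SOME e. e \<in> m)"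
  "egrp (subdivide_at G A) (Whole e) = egrp G e"
  "egrp (subdivide_at G A) (Initial e) = egrp G e"
  "egrp (subdivide_at G A) (Terminal e) = egrp G e"
  "inc (subdivide_at G A) (Whole e) = inc G e"
  "inc (subdivide_at G A) (Initial e) = (\<lambda>h. h)"
  "inc (subdivide_at G A) (Terminal e) = inc G e"
  by (simp_all add: subdivide_at_def)

lemma subdivide_mor_simps [simp]:
  "on_v (subdivide_mor G f) (Old v) = Old (on_v f v)"
  "on_e (subdivide_mor G f) (Whole e) = map_sum Old Whole (on_e f e)"
  "on_e (subdivide_mor G f) (Initial e) = map_sum Old Initial (on_e f e)"
  "on_e (subdivide_mor G f) (Terminal e) = map_sum Old Terminal (on_e f e)"
  "hom_v (subdivide_mor G f) (Old v) = hom_v f v"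
  "hom_e (subdivide_mor G f) (Whole e) = hom_e f e"
  "hom_e (subdivide_mor G f) (Initial e) = hom_e f e"
  "hom_e (subdivide_mor G f) (Terminal e) = hom_e f e"
  "delta (subdivide_mor G f) (Whole e) = delta f e"
  "delta (subdivide_mor G f) (Initial e) = \<one>\<^bsub>cell_grp G (on_e f e)\<^esub>"
  "delta (subdivide_mor G f) (Terminal e) = delta f e"
  by (simp_all add: subdivide_mor_def)

lemma some_in_pair: "(SOME x. x \<in> {a, b}) = a \<or> (SOME x. x \<in> {a, b}) = b"
  using someI[of "\<lambda>x. x \<in> {a, b}" a] by auto

context gog_data
begin

text \<open>The choice of an arc from the pair is harmless because opposite arcs share their edge
  group.\<close>

lemma egrp_some: "e \<in> garcs G \<Longrightarrow> egrp G (SOME x. x \<in> {e, opp G e}) = egrp G e"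
  using some_in_pair[of e "opp G e"] egrp_opp by auto

lemma gog_data_subdivide_at:
  assumes A: "A \<subseteq> garcs G" "opp G ` A \<subseteq> A"
  shows "gog_data (subdivide_at G A)"
proof -
  let ?H = "subdivide_at G A"
  have opp_A: "opp G e \<in> A \<longleftrightarrow> e \<in> A" for e using A(2) by (metis arev_arev image_subset_iff)
  have mid: "{opp G e, e} = {e, opp G e}" for e by auto
  interpret H: wf_digraph "graph ?H"
  proof
    fix x assume "x \<in> garcs ?H"
    then show "gtail ?H x \<in> gverts ?H" "ghead ?H x \<in> gverts ?H"
      using A by (cases x; auto)+
  qed
  have "bidirected_digraph (graph ?H) (opp ?H)"
  proof (rule H.bidirected_digraphI)
    fix x
    show "x \<notin> garcs ?H \<Longrightarrow> opp ?H x = x"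
      using arev_eq by (cases x) auto
    assume x: "x \<in> garcs ?H"
    show "opp ?H x \<noteq> x" using x arev_neq by (cases x) auto
    show "opp ?H (opp ?H x) = x" using x by (cases x) (auto simp: opp_A)
    show "gtail ?H (opp ?H x) = ghead ?H x" using x A by (cases x) (auto simp: opp_A mid)
  qed
  moreover have "group (vgrp ?H v)" if "v \<in> gverts ?H" for v
    using that A group_vgrp group_egrp egrp_some by (auto simp: subset_iff)
  moreover have "group (egrp ?H x)" "egrp ?H (opp ?H x) = egrp ?H x" if "x \<in> garcs ?H" for x
    using that A group_egrp egrp_opp by (cases x; auto)+
  moreover have "inc ?H x \<in> mon (egrp ?H x) (vgrp ?H (ghead ?H x))" if x: "x \<in> garcs ?H" for x
  proof (cases x)
    \<comment> \<open>The half ending at the midpoint is included by the identity, which is sound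
      because the vertex group there is the edge group.\<close>
    case (Initial e)
    then have "vgrp ?H (ghead ?H x) = egrp G e" using egrp_some[of e] x A by auto
    then show ?thesis using Initial by (auto simp: mon_def hom_def)
  qed (use x A inc_mon in auto)
  ultimately show ?thesis by (simp add: gog_data_def)
qed

end

section \<open>Subdividing a morphism\<close>

context gog_mor
begin

text \<open>By \<open>AB\<close>, an uncollapsed arc is cut exactly if its image is, so halves go to
  halves and whole arcs to whole arcs; both halves of a collapsed arc go to its image
  vertex.\<close>

lemma gog_morphism_subdivide:
  assumes A: "A \<subseteq> garcs L" "opp L ` A \<subseteq> A"
    and B: "B \<subseteq> garcs G" "opp G ` B \<subseteq> B"
    and AB: "\<And>x d. x \<in> garcs L \<Longrightarrow> on_e f x = Inr d \<Longrightarrow> x \<in> A \<longleftrightarrow> d \<in> B"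
  shows "gog_morphism (subdivide_at L A) (subdivide_at G B) (subdivide_mor G f)"
proof -
  let ?L = "subdivide_at L A" and ?G = "subdivide_at G B" and ?f = "subdivide_mor G f"
  have hom_e_opp: "hom_e f (opp L x) h = hom_e f x h" if "x \<in> garcs L" "h \<in> carrier (egrp L x)" for x h
    using morphism that by (auto simp: gog_morphism_def)
  have hom_v_inc: "hom_v f (ghead L x) (inc L x h) =
      delta f x \<otimes>\<^bsub>vgrp G (on_v f (ghead L x))\<^esub> cell_inc G (on_e f x) (hom_e f x h)
        \<otimes>\<^bsub>vgrp G (on_v f (ghead L x))\<^esub> inv\<^bsub>vgrp G (on_v f (ghead L x))\<^esub> (delta f x)"
    if "x \<in> garcs L" "h \<in> carrier (egrp L x)" for x h
    using morphism that unfolding gog_morphism_def Let_def by blast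
  \<comment> \<open>The values at a midpoint are independent of the arc picked by
    \<open>SOME\<close>, as \<open>f\<close> respects reversal.\<close>
  have mid: "on_v ?f (Mid {x, opp L x}) = (case on_e f x of Inl w \<Rightarrow> Old w | Inr d \<Rightarrow> Mid {d, opp G d})"
    (is ?mid1)
    "\<And>h. h \<in> carrier (egrp L x) \<Longrightarrow> hom_v ?f (Mid {x, opp L x}) h = hom_e f x h"
    "vgrp ?G (on_v ?f (Mid {x, opp L x})) = cell_grp G (on_e f x)" (is ?mid3)
    if x: "x \<in> garcs L" for x
  proof -
    have s: "(SOME e. e = x \<or> e = opp L x) = x \<or> (SOME e. e = x \<or> e = opp L x) = opp L x"
      using some_in_pair[of x "opp L x"] by simp
    show *: ?mid1
      using s arc_morphism(3)[OF x]
      by (auto simp: subdivide_mor_def insert_commute split: sum.splits)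
    show "\<And>h. h \<in> carrier (egrp L x) \<Longrightarrow> hom_v ?f (Mid {x, opp L x}) h = hom_e f x h"
      using s hom_e_opp[OF x] by (auto simp: subdivide_mor_def)
    show ?mid3
      unfolding * using on_e_InrD[OF x] G.egrp_some by (auto split: sum.splits)
  qed
  have "on_v ?f v \<in> gverts ?G \<and> hom_v ?f v \<in> hom (vgrp ?L v) (vgrp ?G (on_v ?f v))" if v: "v \<in> gverts ?L" for v
  proof (cases v)
    case (Old u)
    then show ?thesis using v on_v_in hom_v_hom by auto
  next
    case (Mid m)
    then obtain x where x: "x \<in> A" "m = {x, opp L x}" using v by auto
    then have xL: "x \<in> garcs L" using A by blast
    have "on_v ?f v \<in> gverts ?G"
      using mid(1)[OF xL] arc_morphism(1)[OF xL] AB[OF xL] x Mid by (auto split: sum.splits)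
    moreover have "vgrp ?L v = egrp L x" using L.egrp_some[OF xL] Mid x(2) by simp
    then have "hom_v ?f v \<in> hom (vgrp ?L v) (vgrp ?G (on_v ?f v))"
      using mid(2,3)[OF xL] arc_morphism(4)[OF xL] L.group_egrp[OF xL] unfolding Mid x(2)
      by (auto simp: hom_def Pi_iff group.is_monoid monoid.m_closed)
    ultimately show ?thesis by blast
  qed
  moreover have "cell_in ?G (on_e ?f y) \<and> cell_head ?G (on_e ?f y) = on_v ?f (ghead ?L y) \<and>
      on_e ?f (opp ?L y) = cell_opp ?G (on_e ?f y) \<and>
      hom_e ?f y \<in> hom (egrp ?L y) (cell_grp ?G (on_e ?f y)) \<and>
      (\<forall>h\<in>carrier (egrp ?L y). hom_e ?f (opp ?L y) h = hom_e ?f y h) \<and>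
      (let M = vgrp ?G (on_v ?f (ghead ?L y)) in delta ?f y \<in> carrier M \<and>
        (\<forall>h\<in>carrier (egrp ?L y). hom_v ?f (ghead ?L y) (inc ?L y h) =
          delta ?f y \<otimes>\<^bsub>M\<^esub> cell_inc ?G (on_e ?f y) (hom_e ?f y h) \<otimes>\<^bsub>M\<^esub> inv\<^bsub>M\<^esub> (delta ?f y)))"
    if y: "y \<in> garcs ?L" for y
  proof (cases y)
    case (Whole x)
    with y have x: "x \<in> garcs L" "x \<notin> A" by auto
    then show ?thesis
      using arc_morphism[OF x(1)] hom_e_opp[OF x(1)] hom_v_inc[OF x(1)] AB[OF x(1)] Whole
      by (cases "on_e f x") (auto simp: Let_def)
  next
    case (Initial x)
    with y have x: "x \<in> A" "x \<in> garcs L" using A by auto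
    interpret N: group "cell_grp G (on_e f x)" using hom_e_one(1)[OF x(2)] .
    have "hom_e f x h \<in> carrier (cell_grp G (on_e f x))" if "h \<in> carrier (egrp L x)" for h
      using arc_morphism(4)[OF x(2)] that by (rule hom_in_carrier)
    \<comment> \<open>On the half ending at the midpoint \<open>delta\<close> is \<open>1\<close>
      and both inclusions are identities, so the twisting condition says that the homomorphism at
      the midpoint is the one on the edge.\<close>
    moreover have "cell_inc ?G (on_e ?f y) = (\<lambda>h. h)" using Initial by (cases "on_e f x") auto
    ultimately have "let M = vgrp ?G (on_v ?f (ghead ?L y)) in delta ?f y \<in> carrier M \<and>
        (\<forall>h\<in>carrier (egrp ?L y). hom_v ?f (ghead ?L y) (inc ?L y h) =
          delta ?f y \<otimes>\<^bsub>M\<^esub> cell_inc ?G (on_e ?f y) (hom_e ?f y h) \<otimes>\<^bsub>M\<^esub> inv\<^bsub>M\<^esub> (delta ?f y))"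
      using Initial mid(2,3)[OF x(2)] by (simp add: Let_def)
    moreover have "cell_in ?G (on_e ?f y) \<and> cell_head ?G (on_e ?f y) = on_v ?f (ghead ?L y) \<and>
      on_e ?f (opp ?L y) = cell_opp ?G (on_e ?f y) \<and>
      hom_e ?f y \<in> hom (egrp ?L y) (cell_grp ?G (on_e ?f y)) \<and>
      (\<forall>h\<in>carrier (egrp ?L y). hom_e ?f (opp ?L y) h = hom_e ?f y h)"
      using arc_morphism(1-4)[OF x(2)] hom_e_opp[OF x(2)] AB[OF x(2)] Initial x(1) mid(1)[OF x(2)]
      by (cases "on_e f x") auto
    ultimately show ?thesis by blast
  next
    case (Terminal x)
    with y have x: "x \<in> A" "x \<in> garcs L" using A by auto
    then show ?thesis
      using arc_morphism[OF x(2)] hom_e_opp[OF x(2)] hom_v_inc[OF x(2)] AB[OF x(2)] Terminal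
      by (cases "on_e f x") (auto simp: Let_def)
  qed
  ultimately show ?thesis unfolding gog_morphism_def by blast
qed

text \<open>Once the base point is a vertex, the vertex case applies; it remains to see that the
  cuts in source and target match.\<close>

lemma has_unique_lift_Mid:
  assumes e: "e \<in> garcs L"
  shows "has_unique_lift (subdivide_at L (source_cut L G f e)) (subdivide_at G (target_cut G f e))
    (subdivide_mor G f) (Mid {e, opp L e})"
proof (rule gog_data_has_unique_lift)
  let ?A = "source_cut L G f e" and ?B = "target_cut G f e"
  have B: "?B \<subseteq> garcs G" "opp G ` ?B \<subseteq> ?B"
    using on_e_InrD[OF e] by (auto simp: target_cut_def split: sum.splits)
  have A: "?A \<subseteq> garcs L" "opp L ` ?A \<subseteq> ?A"
  proof -
    show "?A \<subseteq> garcs L" using e by (auto simp: source_cut_def)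
    have "opp L x \<in> ?A" if "x \<in> ?A" for x
      using that B(2) on_e_InrD[of x] by (auto simp: source_cut_def)
    then show "opp L ` ?A \<subseteq> ?A" by blast
  qed
  \<comment> \<open>If \<open>e\<close> is collapsed, only collapsed arcs are cut in the source and
    none in the target. Otherwise \<open>e\<close> and \<open>opp L e\<close> themselves lie over
    the target cut.\<close>
  have AB: "x \<in> ?A \<longleftrightarrow> d \<in> ?B" if "x \<in> garcs L" "on_e f x = Inr d" for x d
    using that on_e_InrD[OF e] arc_morphism(3)[OF e]
    by (cases "on_e f e") (auto simp: source_cut_def target_cut_def)
  show "gog_data (subdivide_at L ?A)" using L.gog_data_subdivide_at A by blast
  show "gog_data (subdivide_at G ?B)" using G.gog_data_subdivide_at B by blast
  show "gog_morphism (subdivide_at L ?A) (subdivide_at G ?B) (subdivide_mor G f)"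
    using gog_morphism_subdivide A B AB by blast
  show "Mid {e, opp L e} \<in> gverts (subdivide_at L ?A)" by (simp add: source_cut_def)
qed

end

theorem proposition1p10p2:
  fixes \<Lambda> :: "('v, 'e, 'g) gog" and \<Gamma> :: "('w, 'd, 'k) gog"
    and f :: "('v, 'e, 'g, 'w, 'd, 'k) gog_mor"
  assumes "graph_of_groups \<Lambda>" and "graph_of_groups \<Gamma>" and "gog_morphism \<Lambda> \<Gamma> f"
  shows "(\<forall>p \<in> gverts \<Lambda>. has_unique_lift \<Lambda> \<Gamma> f p) \<and>
         (\<forall>e \<in> garcs \<Lambda>.
            has_unique_lift (subdivide_at \<Lambda> (source_cut \<Lambda> \<Gamma> f e)) (subdivide_at \<Gamma> (target_cut \<Gamma> f e))
              (subdivide_mor \<Gamma> f) (Mid {e, opp \<Lambda> e}))"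
proof -
  interpret gog_mor \<Lambda> \<Gamma> f
    using assms by (simp add: gog_mor_def gog_mor_axioms_def graph_of_groups_imp_gog_data)
  show ?thesis
    using gog_data_has_unique_lift[OF L.gog_data_axioms G.gog_data_axioms morphism] has_unique_lift_Mid
    by (intro conjI ballI)
qed

end
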